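(* Let $m\ge 1$ be an integer, let $1\le q<\infty$, and let $\boldsymbol\alpha=(\boldsymbol\alpha_0,\dots,\boldsymbol\alpha_m)$ with $\boldsymbol\alpha_r>0$ for all $r$. Then there is a constant $\kappa_{\boldsymbol\alpha}$, depending only on $\boldsymbol\alpha$ (in particular not on $n$), such that for every integer $n\ge 1$ the Hausdorff distance between the multiball of non-periodic zero-order splines and the non-periodic Sobolev multiball satisfies $$d_{\mathcal H}\big(\mathcal S^{m,q}_{n}(\boldsymbol\alpha),\,W^{m,q}(\boldsymbol\alpha)\big)\le \frac{\kappa_{\boldsymbol\alpha}}{n}.$$
   Context: Fix $d\ge1$ and a norm $\|\cdot\|$ on $\mathbb R^d$. A discretized curve is a family $\mathbf p=(\mathbf p_0,\dots,\mathbf p_{n-1})\in\mathbb R^{n\times d}$ of points of $\mathbb R^d$, with the index convention $\mathbf p_i=\mathbf p_{i \bmod n}$ for $i\in\mathbb Z$. The discrete derivative of order $r$ is $(\Delta^{\star r}\star\mathbf p)_i=\sum_{j=0}^r(-1)^j\binom rj\mathbf p_{i-j}$, i.e. the $r$-fold iterate of $\mathbf p\mapsto(\mathbf p_i-\mathbf p_{i-1})_i$. Non-periodic Sobolev multiball: $W^{m,q}(\boldsymbol\alpha)$ is the set of $f\in L^1([0,1]\to\mathbb R^d)$ whose (weak) derivatives satisfy $\|f^{(r)}\|_{L^q([0,1])}\le\boldsymbol\alpha_r$ for all $0\le r\le m$. Discrete non-periodic multiball: $\mathcal P^{m,q}_{n}(\boldsymbol\alpha)=\big\{\mathbf p\in\mathbb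 R^{n\times d}: n^r\big(\sum_{i=r}^{n-1}\frac1n\|(\Delta^{\star r}\star\mathbf p)_i\|^q\big)^{1/q}\le\boldsymbol\alpha_r \text{ for all } 0\le r\le m\big\}$. Zero-order spline: $s^0(\mathbf p):[0,1]\to\mathbb R^d$, $s^0(\mathbf p)(t)=\mathbf p_{\lfloor nt\rfloor}$, and $\mathcal S^{m,q}_{n}(\boldsymbol\alpha)=\{s^0(\mathbf p):\mathbf p\in\mathcal P^{m,q}_{n}(\boldsymbol\alpha)\}$. Distance between curves: $d(f,g)=\int_0^1\|f(t)-g(t)\|\,dt$. Hausdorff distance between two sets of curves: $d_{\mathcal H}(A,B)=\sup_{f\in A}\inf_{g\in B}d(f,g)+\sup_{g\in B}\inf_{f\in A}d(f,g)$. *)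

theory Defs
  imports "HOL-Analysis.Analysis"
begin

definition is_norm :: "('v::real_vector \<Rightarrow> real) \<Rightarrow> bool" where
  "is_norm N \<longleftrightarrow>
     (\<forall>x. N x = 0 \<longleftrightarrow> x = 0) \<and>
     (\<forall>c x. N (c *\<^sub>R x) = \<bar>c\<bar> * N x) \<and>
     (\<forall>x y. N (x + y) \<le> N x + N y)"

text \<open>Integer-indexed families with the convention \<open>p i = p (i mod n)\<close>; for \<open>n \<ge> 1\<close> such a
  family is the same thing as the tuple \<open>(p 0, \<dots>, p (n - 1))\<close>.\<close>

definition discrete_curves :: "nat \<Rightarrow> (int \<Rightarrow> real ^ 'd) set" where
  "discrete_curves n = {p. \<forall>i. p i = p (i mod int n)}"

definition discrete_deriv :: "nat \<Rightarrow> (int \<Rightarrow> real ^ 'd) \<Rightarrow> int \<Rightarrow> real ^ 'd" where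
  "discrete_deriv r p i = (\<Sum>j = 0..r. ((-1) ^ j * real (r choose j)) *\<^sub>R p (i - int j))"

text \<open>For \<open>r \<ge> n\<close> the sum is empty and the constraint of order \<open>r\<close> holds trivially.\<close>

definition discrete_multiball ::
  "(real ^ 'd \<Rightarrow> real) \<Rightarrow> nat \<Rightarrow> real \<Rightarrow> nat \<Rightarrow> (nat \<Rightarrow> real) \<Rightarrow> (int \<Rightarrow> real ^ 'd) set" where
  "discrete_multiball N m q n \<alpha> =
     {p \<in> discrete_curves n. \<forall>r\<le>m.
        real n ^ r * (\<Sum>i = r..<n. 1 / real n * N (discrete_deriv r p (int i)) powr q) powr (1 / q)
          \<le> \<alpha> r}"

definition zero_spline :: "nat \<Rightarrow> (int \<Rightarrow> real ^ 'd) \<Rightarrow> real \<Rightarrow> real ^ 'd" where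
  "zero_spline n p t = p \<lfloor>real n * t\<rfloor>"

definition spline_multiball ::
  "(real ^ 'd \<Rightarrow> real) \<Rightarrow> nat \<Rightarrow> real \<Rightarrow> nat \<Rightarrow> (nat \<Rightarrow> real) \<Rightarrow> (real \<Rightarrow> real ^ 'd) set" where
  "spline_multiball N m q n \<alpha> = zero_spline n ` discrete_multiball N m q n \<alpha>"

text \<open>Smooth functions with compact support in the open unit interval (the closed support is
  automatically compact, being bounded).\<close>

definition test_functions :: "(real \<Rightarrow> real) set" where
  "test_functions =
     {\<phi>. (\<forall>k x. (deriv ^^ k) \<phi> differentiable at x) \<and> closure {x. \<phi> x \<noteq> 0} \<subseteq> {0<..<1}}"

definition weak_deriv :: "nat \<Rightarrow> (real \<Rightarrow> real ^ 'd) \<Rightarrow> (real \<Rightarrow> real ^ 'd) \<Rightarrow> bool" where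
  "weak_deriv r f g \<longleftrightarrow>
     (\<forall>K. compact K \<and> K \<subseteq> {0<..<1} \<longrightarrow> g absolutely_integrable_on K) \<and>
     (\<forall>\<phi>\<in>test_functions.
        integral {0..1} (\<lambda>t. (deriv ^^ r) \<phi> t *\<^sub>R f t)
          = (-1) ^ r *\<^sub>R integral {0..1} (\<lambda>t. \<phi> t *\<^sub>R g t))"

definition Lq_norm :: "(real ^ 'd \<Rightarrow> real) \<Rightarrow> real \<Rightarrow> (real \<Rightarrow> real ^ 'd) \<Rightarrow> real" where
  "Lq_norm N q g = (integral {0..1} (\<lambda>t. N (g t) powr q)) powr (1 / q)"

text \<open>Curves are represented by functions on the whole line, of which only the restriction to
  \<open>{0..1}\<close> (up to null sets) matters. The integrability clause says that the norm of the \<open>r\<close>-th weak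
  derivative \<open>g\<close> is finite; \<open>g\<close> is unique up to null sets.\<close>

definition sobolev_multiball ::
  "(real ^ 'd \<Rightarrow> real) \<Rightarrow> nat \<Rightarrow> real \<Rightarrow> (nat \<Rightarrow> real) \<Rightarrow> (real \<Rightarrow> real ^ 'd) set" where
  "sobolev_multiball N m q \<alpha> =
     {f. f absolutely_integrable_on {0..1} \<and>
         (\<forall>r\<le>m. \<exists>g. weak_deriv r f g \<and>
            (\<lambda>t. N (g t) powr q) absolutely_integrable_on {0..1} \<and> Lq_norm N q g \<le> \<alpha> r)}"

definition curve_dist ::
  "(real ^ 'd \<Rightarrow> real) \<Rightarrow> (real \<Rightarrow> real ^ 'd) \<Rightarrow> (real \<Rightarrow> real ^ 'd) \<Rightarrow> real" where
  "curve_dist N f g = integral {0..1} (\<lambda>t. N (f t - g t))"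

text \<open>Taken in \<open>ennreal\<close> so that the suprema and infima are genuine ones even for unbounded sets.\<close>

definition hausdorff_curve_dist ::
  "(real ^ 'd \<Rightarrow> real) \<Rightarrow> (real \<Rightarrow> real ^ 'd) set \<Rightarrow> (real \<Rightarrow> real ^ 'd) set \<Rightarrow> ennreal" where
  "hausdorff_curve_dist N A B =
     (SUP f\<in>A. INF g\<in>B. ennreal (curve_dist N f g)) +
     (SUP g\<in>B. INF f\<in>A. ennreal (curve_dist N f g))"

end

theory Submission
  imports Defs
begin

text \<open>
  With \<open>h = 1 / n\<close>, let \<open>D u t = (u t - u (t - h)) / h\<close> and let \<open>M u t\<close> be the average of \<open>u\<close> over
  \<open>[t - h, t]\<close>. If \<open>w\<close> is the derivative of \<open>u\<close> then \<open>D u = M w\<close>; moreover \<open>D\<close> and \<open>M\<close> commute,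
  \<open>D u\<close> is the derivative of \<open>M u\<close>, and by Jensen's inequality \<open>M\<close> does not increase the \<open>L\<^sup>q\<close> norm,
  at the cost of losing an interval of length \<open>h\<close> on the left.

  Given \<open>f\<close> in the Sobolev multiball, the cell averages \<open>p i = M f ((i + 1) h)\<close> satisfy
  \<open>n\<^sup>r \<Delta>\<^sup>r p i = M (M\<^sup>r f\<^sup>(\<^sup>r\<^sup>)) ((i + 1) h)\<close>, so \<open>p\<close> obeys the discrete constraints with the same
  bounds, and its spline is within \<open>h \<integral>\<parallel>f'\<parallel>\<close> of \<open>f\<close>.

  Conversely, for a spline \<open>s\<close> the function \<open>M\<^sup>m s\<close> has derivatives \<open>M\<^sup>m\<^sup>-\<^sup>r D\<^sup>r s\<close>, which obey the
  constraints on \<open>[m h, 1]\<close>. Stretching this interval to \<open>[0, 1]\<close> shrinks derivatives and increases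
  the norm of order \<open>0\<close> by at most \<open>1 / (1 - m h)\<close>, which is compensated by the factor \<open>1 - m h\<close>.
\<close>

text \<open>Passing from \<open>f\<close> to cell averages needs identities valid at every point,
  whereas the multiball supplies, for each order separately, a weak derivative of \<open>f\<close>
  known only up to null sets and a priori only locally integrable. Much of the work extracts from
  this a chain of functions on the whole line, each a primitive of the next; bump functions and the
  lemma of du Bois-Reymond serve this purpose.

  Values to the left of 0 carry no bound: for a Sobolev function they come from an arbitrary
  extension, for a spline from the wrap-around, whose jump the constraints do not see. Hence each
  average and each difference costs a length \<open>h\<close>. After \<open>m\<close> of them
  \<open>[m h, 1]\<close> is left whatever the order, so a single stretching serves all orders.

  In the constant, \<alpha> 1 comes from the cell averages. In
  \<open>2 m (\<alpha> 0 + \<alpha> 1)\<close>, smoothing over a window of length \<open>m h\<close>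
  costs \<open>m h\<close> times the total variation, stretching costs \<open>m h\<close> times the
  \<open>L^1\<close> norm, and the 2 bounds \<open>1 / (1 - m h)\<close> for
  \<open>n \<ge> 2 m\<close>. For smaller \<open>n\<close> the zero function is close enough. All
  \<open>L^1\<close> bounds come from \<open>L^q\<close> bounds on intervals of length at most 1, so
  \<open>q\<close> does not enter.\<close>

section \<open>Primitives, averages and difference quotients\<close>

text \<open>Required on every interval of the line rather than on \<open>{0..1}\<close>, so that
  translates and backward averages are defined without side conditions.\<close>

definition loc_int :: "(real \<Rightarrow> 'a::euclidean_space) \<Rightarrow> bool" where
  "loc_int u \<longleftrightarrow> (\<forall>a b. u absolutely_integrable_on {a..b})"

text \<open>The integral form of \<open>u' = w\<close> for an absolutely continuous
  \<open>u\<close>, which may fail to be differentiable on a null set. Averages respect this form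
  exactly.\<close>

definition primitive :: "(real \<Rightarrow> 'a::euclidean_space) \<Rightarrow> (real \<Rightarrow> 'a) \<Rightarrow> bool" where
  "primitive u w \<longleftrightarrow> loc_int w \<and> (\<forall>a b. a \<le> b \<longrightarrow> integral {a..b} w = u b - u a)"

text \<open>The \<open>M\<close> of the overview. The window trails \<open>t\<close> because the
  discrete derivative is a backward difference.\<close>

definition steklov :: "real \<Rightarrow> (real \<Rightarrow> 'a::euclidean_space) \<Rightarrow> real \<Rightarrow> 'a" where
  "steklov h u t = (1 / h) *\<^sub>R integral {t - h..t} u"

definition diff_quot :: "real \<Rightarrow> (real \<Rightarrow> 'a::real_vector) \<Rightarrow> real \<Rightarrow> 'a" where
  "diff_quot h u t = (1 / h) *\<^sub>R (u t - u (t - h))"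

lemma loc_int_abs: "loc_int u \<Longrightarrow> u absolutely_integrable_on {a..b}"
  by (simp add: loc_int_def)

lemma loc_int_integrable: "loc_int u \<Longrightarrow> u integrable_on {a..b}"
  using loc_int_abs absolutely_integrable_on_def by blast

lemma loc_int_combine:
  "loc_int u \<Longrightarrow> a \<le> c \<Longrightarrow> c \<le> b \<Longrightarrow> integral {a..c} u + integral {c..b} u = integral {a..b} u"
  by (simp add: Henstock_Kurzweil_Integration.integral_combine loc_int_integrable)

lemma loc_int_continuous: "continuous_on UNIV u \<Longrightarrow> loc_int u"
  unfolding loc_int_def
  by (meson absolutely_integrable_continuous_real continuous_on_subset subset_UNIV)

lemma loc_int_shift:
  assumes "loc_int u" shows "loc_int (\<lambda>t. u (t + c))"
  unfolding loc_int_def absolutely_integrable_on_def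
proof (intro allI conjI)
  fix a b
  show "(\<lambda>t. u (t + c)) integrable_on {a..b}"
    using integrable_shift_real_ivl[OF loc_int_integrable[OF assms], of c "a + c" "b + c"] by simp
  have "(\<lambda>t. norm (u t)) integrable_on {a + c..b + c}"
    using loc_int_abs[OF assms] by (simp add: absolutely_integrable_on_def)
  then show "(\<lambda>t. norm (u (t + c))) integrable_on {a..b}"
    using integrable_shift_real_ivl[of "\<lambda>t. norm (u t)" "a + c" "b + c" c] by simp
qed

lemma loc_int_diff: "loc_int u \<Longrightarrow> loc_int v \<Longrightarrow> loc_int (\<lambda>t. u t - v t)"
  by (simp add: loc_int_def set_integral_diff(1))

lemma loc_int_scaleR: "loc_int u \<Longrightarrow> loc_int (\<lambda>t. c *\<^sub>R u t)"
  by (simp add: loc_int_def)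

lemma loc_int_diff_quot: "loc_int u \<Longrightarrow> loc_int (diff_quot h u)"
  unfolding diff_quot_def[abs_def]
  using loc_int_scaleR[OF loc_int_diff[OF _ loc_int_shift[of u "- h"]]] by simp

lemma integral_shift_Icc:
  fixes u :: "real \<Rightarrow> 'a::euclidean_space"
  shows "integral {a..b} (\<lambda>t. u (t - c)) = integral {a - c..b - c} u"
  using integral_shift_real_ivl[of "a - c" "- c" "b - c" u] by simp

lemma primitive_continuous:
  assumes "primitive u w" shows "continuous_on UNIV u"
proof -
  have "isCont u x" for x
  proof -
    have w: "w integrable_on {x - 1..x + 1}"
      using assms loc_int_integrable unfolding primitive_def by blast
    have "continuous_on {x - 1..x + 1} (\<lambda>t. u (x - 1) + integral {x - 1..t} w)"
      by (intro continuous_intros indefinite_integral_continuous_1 w)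
    moreover have "u (x - 1) + integral {x - 1..t} w = u t" if "t \<in> {x - 1..x + 1}" for t
      using assms that by (simp add: primitive_def)
    ultimately have "continuous_on {x - 1..x + 1} u"
      by (metis (no_types, lifting) continuous_on_cong)
    then show "isCont u x"
      by (rule continuous_on_interior) simp
  qed
  then show ?thesis by (simp add: continuous_at_imp_continuous_on)
qed

lemma primitive_loc_int: "primitive u w \<Longrightarrow> loc_int u"
  by (simp add: loc_int_continuous primitive_continuous)

lemma primitive_diff_quot:
  assumes "primitive u w" "h > 0" shows "diff_quot h u = steklov h w"
  using assms by (auto simp: primitive_def diff_quot_def steklov_def)

lemma primitive_steklov:
  assumes u: "loc_int u" and "h > 0"
  shows "primitive (steklov h u) (diff_quot h u)"
  unfolding primitive_def
proof (intro conjI allI impI loc_int_diff_quot u)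
  fix a b :: real assume ab: "a \<le> b"
  note i = loc_int_integrable[OF u]
  have i2: "(\<lambda>t. u (t - h)) integrable_on {a..b}"
    using loc_int_integrable[OF loc_int_shift[OF u, of "- h"]] by simp
  have "integral {a..b} (diff_quot h u) = (1/h) *\<^sub>R (integral {a..b} u - integral {a-h..b-h} u)"
    unfolding diff_quot_def[abs_def] using i i2
    by (simp add: integral_diff integral_shift_Icc)
  \<comment> \<open>Both sides become the integral over \<open>{a-h..b}\<close> after adding the two
    subtracted integrals, so \<open>h\<close> may exceed \<open>b - a\<close>.\<close>
  also have "integral {a..b} u - integral {a-h..b-h} u = integral {b-h..b} u - integral {a-h..a} u"
    using loc_int_combine[OF u, of "a-h" a b] loc_int_combine[OF u, of "a-h" "b-h" b] ab \<open>h > 0\<close>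
    by (simp add: algebra_simps)
  finally show "integral {a..b} (diff_quot h u) = steklov h u b - steklov h u a"
    by (simp add: steklov_def scaleR_diff_right)
qed

lemma primitive_steklov_steklov:
  assumes "primitive u w" "h > 0"
  shows "primitive (steklov h u) (steklov h w)"
  using primitive_steklov[OF primitive_loc_int[OF assms(1)] assms(2)]
  by (simp add: primitive_diff_quot[OF assms])

lemma loc_int_steklov: "loc_int u \<Longrightarrow> h > 0 \<Longrightarrow> loc_int (steklov h u)"
  using primitive_loc_int primitive_steklov by blast

text \<open>Commutation is the identity \<open>D u = M w\<close> applied to \<open>M u\<close>,
  whose derivative is \<open>D u\<close>.\<close>

lemma steklov_diff_quot:
  assumes u: "loc_int u" and "h > 0"
  shows "steklov h (diff_quot h u) = diff_quot h (steklov h u)"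
  by (metis assms primitive_diff_quot primitive_steklov)

lemma loc_int_steklov_funpow: "loc_int u \<Longrightarrow> h > 0 \<Longrightarrow> loc_int ((steklov h ^^ k) u)"
  by (induction k) (auto intro: loc_int_steklov)

lemma loc_int_diff_quot_funpow: "loc_int u \<Longrightarrow> loc_int ((diff_quot h ^^ k) u)"
  by (induction k) (auto intro: loc_int_diff_quot)

lemma steklov_funpow_diff_quot:
  assumes u: "loc_int u" and "h > 0"
  shows "diff_quot h ((steklov h ^^ k) u) = (steklov h ^^ k) (diff_quot h u)"
  by (induction k) (use assms in \<open>auto simp: steklov_diff_quot[symmetric] loc_int_steklov_funpow\<close>)

lemma primitive_steklov_funpow:
  assumes "primitive u w" "h > 0"
  shows "primitive ((steklov h ^^ k) u) ((steklov h ^^ k) w)"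
  by (induction k) (use assms in \<open>auto intro: primitive_steklov_steklov\<close>)

text \<open>Each difference quotient is traded for one derivative and one average; the averages
  already collected do not interfere, since averaging a whole chain gives a chain again.\<close>

lemma diff_quot_funpow_chain:
  assumes "\<And>j. j < r \<Longrightarrow> primitive (u j) (u (Suc j))" "h > 0"
  shows "(diff_quot h ^^ r) (u 0) = (steklov h ^^ r) (u r)"
  using assms(1)
proof (induction r)
  case (Suc r)
  then have "(diff_quot h ^^ Suc r) (u 0) = diff_quot h ((steklov h ^^ r) (u r))"
    by simp
  also have "\<dots> = steklov h ((steklov h ^^ r) (u (Suc r)))"
    using primitive_diff_quot[OF primitive_steklov_funpow] Suc.prems \<open>h > 0\<close> by blast
  finally show ?case by simp
qed simp

section \<open>Affine substitution and primitives on the whole line\<close>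

lemma has_integral_affine:
  fixes v :: "real \<Rightarrow> 'a::euclidean_space"
  assumes "(v has_integral i) {c * a + d..c * b + d}" "c > 0"
  shows "((\<lambda>t. v (c * t + d)) has_integral (i /\<^sub>R c)) {a..b}"
proof -
  have "((\<lambda>x. v (c *\<^sub>R x + d)) has_integral i /\<^sub>R c ^ DIM(real))
    (cbox ((c * a + d - d) /\<^sub>R c) ((c * b + d - d) /\<^sub>R c))"
    using assms by (intro has_integral_affinity') auto
  moreover have "inverse c * (c * x) = x" for x using \<open>c > 0\<close> by simp
  ultimately show ?thesis by simp
qed

lemma integrable_affine:
  fixes v :: "real \<Rightarrow> 'a::euclidean_space"
  shows "v integrable_on {c * a + d..c * b + d} \<Longrightarrow> c > 0 \<Longrightarrow> (\<lambda>t. v (c * t + d)) integrable_on {a..b}"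
  using has_integral_affine by (metis integrable_on_def)

lemma primitive_affine:
  assumes "primitive u w" "c > 0"
  shows "primitive (\<lambda>t. u (c * t + d)) (\<lambda>t. c *\<^sub>R w (c * t + d))"
proof -
  have w: "loc_int w" using assms primitive_def by blast
  have "loc_int (\<lambda>t. w (c * t + d))"
    unfolding loc_int_def absolutely_integrable_on_def
  proof (intro allI conjI)
    fix a b
    show "(\<lambda>t. w (c * t + d)) integrable_on {a..b}"
      using has_integral_affine[OF integrable_integral[OF loc_int_integrable[OF w]]] assms
      by (meson integrable_on_def)
    have "(\<lambda>t. norm (w t)) integrable_on {c * a + d..c * b + d}"
      using loc_int_abs[OF w] by (simp add: absolutely_integrable_on_def)
    then show "(\<lambda>t. norm (w (c * t + d))) integrable_on {a..b}"
      using \<open>c > 0\<close> by (rule integrable_affine)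
  qed
  moreover have "integral {a..b} (\<lambda>t. w (c * t + d)) = (u (c * b + d) - u (c * a + d)) /\<^sub>R c" if "a \<le> b" for a b
    proof -
    have "((\<lambda>t. w (c * t + d)) has_integral (integral {c * a + d..c * b + d} w /\<^sub>R c)) {a..b}"
      by (intro has_integral_affine integrable_integral loc_int_integrable w assms)
    then show ?thesis using that assms by (auto simp: primitive_def dest!: integral_unique)
  qed
  ultimately show ?thesis
    using \<open>c > 0\<close> by (simp add: primitive_def loc_int_scaleR)
qed

text \<open>The integral over \<open>{0..t}\<close> is 0 for negative \<open>t\<close>, the interval
  being empty, so the orientation has to be put in by hand.\<close>

definition signed_integral :: "(real \<Rightarrow> 'a::euclidean_space) \<Rightarrow> real \<Rightarrow> 'a" where
  "signed_integral w t = (if 0 \<le> t then integral {0..t} w else - integral {t..0} w)"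

lemma primitive_signed_integral:
  assumes w: "loc_int w" shows "primitive (\<lambda>t. c + signed_integral w t) w"
  unfolding primitive_def
proof (intro conjI w allI impI)
  fix a b :: real assume "a \<le> b"
  note i = loc_int_integrable[OF w]
  consider "0 \<le> a" | "a < 0" "0 \<le> b" | "b < 0" by linarith
  then show "integral {a..b} w = c + signed_integral w b - (c + signed_integral w a)"
  proof cases
    case 1 then show ?thesis using loc_int_combine[OF w, of 0 a b] \<open>a \<le> b\<close>
      by (auto simp: signed_integral_def algebra_simps)
  next
    case 2 then show ?thesis using loc_int_combine[OF w, of a 0 b]
      by (auto simp: signed_integral_def algebra_simps)
  next
    case 3 then show ?thesis using loc_int_combine[OF w, of a b 0] \<open>a \<le> b\<close>
      by (auto simp: signed_integral_def algebra_simps)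
  qed
qed

section \<open>Norms and Jensen's inequality\<close>

lemma is_norm_zero: "is_norm N \<Longrightarrow> N 0 = 0" by (simp add: is_norm_def)
lemma is_norm_scaleR: "is_norm N \<Longrightarrow> N (c *\<^sub>R x) = \<bar>c\<bar> * N x" by (simp add: is_norm_def)
lemma is_norm_triangle: "is_norm N \<Longrightarrow> N (x + y) \<le> N x + N y" by (simp add: is_norm_def)

lemma is_norm_minus: "is_norm N \<Longrightarrow> N (- x) = N x"
  using is_norm_scaleR[of N "-1" x] by simp

lemma is_norm_nonneg: assumes "is_norm N" shows "0 \<le> N x"
  using is_norm_triangle[OF assms, of x "- x"] is_norm_minus[OF assms, of x] is_norm_zero[OF assms] by simp

lemma is_norm_commute: "is_norm N \<Longrightarrow> N (x - y) = N (y - x)"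
  by (metis is_norm_minus minus_diff_eq)

lemma is_norm_triangle3: "is_norm N \<Longrightarrow> N (x - z) \<le> N (x - y) + N (y - z)"
  using is_norm_triangle[of N "x - y" "y - z"] by simp

lemma is_norm_le_norm:
  fixes N :: "'a::euclidean_space \<Rightarrow> real"
  assumes "is_norm N" obtains C where "C > 0" "\<And>x. N x \<le> C * norm x"
proof
  let ?C = "1 + (\<Sum>b\<in>Basis. N b)"
  show "?C > 0" using is_norm_nonneg[OF assms] by (smt (verit) sum_nonneg)
  fix x
  have "N (\<Sum>b\<in>B. (x \<bullet> b) *\<^sub>R b) \<le> (\<Sum>b\<in>B. \<bar>x \<bullet> b\<bar> * N b)" if "finite B" for B
    using that
  proof induction
    case (insert b B)
    then show ?case
      using is_norm_triangle[OF assms, of "(x \<bullet> b) *\<^sub>R b" "\<Sum>b\<in>B. (x \<bullet> b) *\<^sub>R b"]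
      by (simp add: is_norm_scaleR[OF assms])
  qed (simp add: is_norm_zero[OF assms])
  from this[OF finite_Basis] have "N x \<le> (\<Sum>b\<in>Basis. \<bar>x \<bullet> b\<bar> * N b)"
    by (simp add: euclidean_representation)
  also have "\<dots> \<le> (\<Sum>b\<in>Basis. norm x * N b)"
    by (intro sum_mono mult_right_mono Basis_le_norm is_norm_nonneg assms)
  also have "\<dots> = norm x * (\<Sum>b\<in>Basis. N b)" by (simp add: sum_distrib_left)
  finally show "N x \<le> ?C * norm x" by (simp add: algebra_simps) (smt (verit) norm_ge_zero)
qed

lemma is_norm_continuous:
  fixes N :: "'a::euclidean_space \<Rightarrow> real"
  assumes "is_norm N" shows "continuous_on S N"
proof -
  obtain C where C: "C > 0" "\<And>x. N x \<le> C * norm x" using is_norm_le_norm[OF assms] by blast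
  have "C-lipschitz_on S N"
  proof (rule lipschitz_onI)
    fix x y
    have "\<bar>N x - N y\<bar> \<le> N (x - y)"
      using is_norm_triangle[OF assms, of "x - y" y] is_norm_triangle[OF assms, of "y - x" x]
        is_norm_commute[OF assms, of x y] by simp
    then show "dist (N x) (N y) \<le> C * dist x y"
      using C(2)[of "x - y"] by (simp add: dist_norm)
  qed (use C in simp)
  then show ?thesis by (rule lipschitz_on_continuous_on)
qed

text \<open>Hahn-Banach in finite dimension: a hyperplane separates \<open>v\<close> from the open
  ball \<open>{x. N x < N v}\<close>, and its normal is rescaled to attain \<open>N v\<close> at
  \<open>v\<close>. It lets an arbitrary norm be handled through linear functionals.\<close>

lemma is_norm_supporting_functional:
  fixes N :: "'a::euclidean_space \<Rightarrow> real"
  assumes N: "is_norm N"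
  obtains a where "a \<bullet> v = N v" "\<And>x. a \<bullet> x \<le> N x"
proof (cases "v = 0")
  case True
  then show ?thesis using that[of 0] is_norm_nonneg[OF N] is_norm_zero[OF N] by simp
next
  case False
  then have Nv: "N v > 0" using N is_norm_nonneg[OF N, of v] by (auto simp: is_norm_def less_le)
  let ?S = "{x. N x < N v}"
  have "convex ?S"
  proof (rule convexI)
    fix x y u w :: real and xx yy
    assume "xx \<in> ?S" "yy \<in> ?S" "0 \<le> u" "0 \<le> w" "u + w = 1"
    moreover have "N (u *\<^sub>R xx + w *\<^sub>R yy) \<le> u * N xx + w * N yy"
      using is_norm_triangle[OF N, of "u *\<^sub>R xx" "w *\<^sub>R yy"] \<open>0 \<le> u\<close> \<open>0 \<le> w\<close>
      by (simp add: is_norm_scaleR[OF N])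
    ultimately show "u *\<^sub>R xx + w *\<^sub>R yy \<in> ?S"
      using convex_bound_lt[of "N xx" "N v" "N yy" u w] by auto
  qed
  moreover have "?S \<inter> {v} = {}" "?S \<noteq> {}" using Nv is_norm_zero[OF N] by (auto intro!: exI[of _ 0])
  ultimately obtain a b where ab: "a \<noteq> 0" "\<forall>x\<in>?S. a \<bullet> x \<le> b" "\<forall>x\<in>{v}. a \<bullet> x \<ge> b"
    using separating_hyperplane_sets[of ?S "{v}"] by auto
  \<comment> \<open>For \<open>c > N x\<close> the vector \<open>(N v / c) *\<^sub>R x\<close> lies
    in the open ball. Letting \<open>c\<close> decrease to \<open>N x\<close> instead of dividing by
    \<open>N x\<close> covers \<open>N x = 0\<close> too.\<close>
  have scaled: "N v * (a \<bullet> x) \<le> (a \<bullet> v) * N x" for x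
  proof -
    have *: "N v * (a \<bullet> x) \<le> (a \<bullet> v) * c" if "c > N x" for c
    proof -
      have "c > 0" using that is_norm_nonneg[OF N, of x] by simp
      then have "N ((N v / c) *\<^sub>R x) < N v"
        using that Nv by (simp add: is_norm_scaleR[OF N] field_simps)
      then have "a \<bullet> ((N v / c) *\<^sub>R x) \<le> a \<bullet> v" using ab by force
      then show ?thesis using \<open>c > 0\<close> by (simp add: field_simps)
    qed
    show ?thesis
    proof (rule tendsto_lowerbound)
      show "((\<lambda>c. (a \<bullet> v) * c) \<longlongrightarrow> (a \<bullet> v) * N x) (at_right (N x))" by (intro tendsto_intros)
      show "\<forall>\<^sub>F c in at_right (N x). N v * (a \<bullet> x) \<le> (a \<bullet> v) * c"
        using * by (auto simp: eventually_at_right_field intro!: exI[of _ "N x + 1"])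
    qed simp
  qed
  \<comment> \<open>Testing \<open>scaled\<close> on \<open>a\<close> itself rules out a hyperplane
    through the origin.\<close>
  have "a \<bullet> v > 0"
  proof -
    have "N v * (a \<bullet> a) \<le> (a \<bullet> v) * N a" by (rule scaled)
    moreover have "N v * (a \<bullet> a) > 0" using ab Nv by simp
    ultimately show ?thesis using is_norm_nonneg[OF N, of a] by (smt (verit) mult_nonpos_nonneg)
  qed
  then show ?thesis
    using that[of "(N v / (a \<bullet> v)) *\<^sub>R a"] scaled by (simp add: field_simps)
qed

lemma absolutely_integrable_is_norm:
  fixes u :: "real \<Rightarrow> 'a::euclidean_space"
  assumes N: "is_norm N" and u: "u absolutely_integrable_on S" and S: "S \<in> sets lebesgue"
  shows "(\<lambda>t. N (u t)) absolutely_integrable_on S"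
proof -
  obtain C where C: "C > 0" "\<And>x. N x \<le> C * norm x" using is_norm_le_norm[OF N] by blast
  show ?thesis
  proof (rule measurable_bounded_by_integrable_imp_absolutely_integrable[OF _ S])
    have "N \<in> borel_measurable borel" by (rule borel_measurable_continuous_onI[OF is_norm_continuous[OF N]])
    then show "(\<lambda>t. N (u t)) \<in> borel_measurable (lebesgue_on S)"
      using absolutely_integrable_imp_borel_measurable[OF u S] by measurable
    show "(\<lambda>t. C * norm (u t)) integrable_on S"
      using u by (intro integrable_on_mult_right) (simp add: absolutely_integrable_on_def)
    show "norm (N (u t)) \<le> C * norm (u t)" for t using C is_norm_nonneg[OF N] by simp
  qed
qed

lemma loc_int_is_norm: "is_norm N \<Longrightarrow> loc_int u \<Longrightarrow> loc_int (\<lambda>t. N (u t))"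
  unfolding loc_int_def by (simp add: absolutely_integrable_is_norm)

text \<open>The functional that attains the norm of the integral can be moved under the integral,
  where it is at most \<open>N\<close>.\<close>

lemma is_norm_integral_le:
  fixes u :: "real \<Rightarrow> 'a::euclidean_space"
  assumes N: "is_norm N" and u: "u absolutely_integrable_on S" and S: "S \<in> sets lebesgue"
  shows "N (integral S u) \<le> integral S (\<lambda>t. N (u t))"
proof -
  obtain a where a: "a \<bullet> integral S u = N (integral S u)" "\<And>x. a \<bullet> x \<le> N x"
    using is_norm_supporting_functional[OF N] by blast
  have iu: "u integrable_on S" using u absolutely_integrable_on_def by blast
  have "N (integral S u) = integral S (\<lambda>t. a \<bullet> u t)"
    using integral_linear[OF iu bounded_linear_inner_right[of a]] a by (simp add: o_def)
  also have "\<dots> \<le> integral S (\<lambda>t. N (u t))"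
    using integrable_linear[OF iu bounded_linear_inner_right[of a]]
      absolutely_integrable_is_norm[OF N u S] a
    by (intro integral_le) (auto simp: o_def absolutely_integrable_on_def)
  finally show ?thesis .
qed

text \<open>Convexity: the graph of \<open>y powr q\<close> lies above its tangent at
  \<open>c\<close>. With \<open>x = y / c\<close> this is Bernoulli's inequality
  \<open>1 + q (x - 1) \<le> x powr q\<close>, which is Young's inequality for
  \<open>x powr q\<close> and 1 with weights \<open>1 / q\<close> and
  \<open>1 - 1 / q\<close>.\<close>

lemma powr_tangent_le:
  fixes c y q :: real
  assumes "q \<ge> 1" "c > 0" "y \<ge> 0"
  shows "c powr q + q * c powr (q - 1) * (y - c) \<le> y powr q"
proof (cases "y = 0")
  case True
  have "c powr q = c powr (q - 1) * c" using assms by (simp add: powr_diff)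
  then have "c powr q + q * c powr (q - 1) * (y - c) = (1 - q) * c powr q"
    using True by (simp add: algebra_simps)
  then show ?thesis using assms True by (simp add: mult_nonpos_nonneg)
next
  case False
  let ?x = "y / c"
  have x: "?x > 0" using False assms by simp
  have "(?x powr q) powr (1 / q) * 1 powr (1 - 1 / q) \<le> (1 / q) * ?x powr q + (1 - 1 / q) * 1"
    using assms x by (intro Youngs_inequality_0) auto
  then have "?x \<le> (1 / q) * ?x powr q + (1 - 1 / q)" using assms x by (simp add: powr_powr)
  then have "q * ?x \<le> q * ((1 / q) * ?x powr q + (1 - 1 / q))" using assms by (intro mult_left_mono) auto
  also have "\<dots> = ?x powr q + q - 1" using assms by (simp add: distrib_left right_diff_distrib)
  finally have "1 + q * (?x - 1) \<le> ?x powr q" by (simp add: right_diff_distrib)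
  then have "c powr q * (1 + q * (?x - 1)) \<le> c powr q * ?x powr q" by (intro mult_left_mono) auto
  also have "\<dots> = y powr q" using assms by (simp add: powr_divide)
  also have "c powr q * (1 + q * (?x - 1)) = c powr q + q * (c powr q / c) * (y - c)"
    using assms by (simp add: field_simps)
  finally show ?thesis using assms by (simp add: powr_diff)
qed

text \<open>Jensen's inequality: integrate the tangent inequality taken at the mean
  \<open>c\<close>; the linear term integrates to 0. A zero mean is separate because the tangent
  lemma wants \<open>c > 0\<close>.\<close>

lemma powr_average_le:
  fixes v :: "real \<Rightarrow> real"
  assumes "a < b" "q \<ge> 1" and v: "v integrable_on {a..b}" and vq: "(\<lambda>t. v t powr q) integrable_on {a..b}"
    and nn: "\<And>t. t \<in> {a..b} \<Longrightarrow> 0 \<le> v t"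
  shows "(1 / (b - a) * integral {a..b} v) powr q \<le> 1 / (b - a) * integral {a..b} (\<lambda>t. v t powr q)"
proof -
  define c where "c = 1 / (b - a) * integral {a..b} v"
  have iv: "integral {a..b} v \<ge> 0" using nn v by (intro integral_nonneg) auto
  show ?thesis
  proof (cases "c = 0")
    case True
    have "integral {a..b} (\<lambda>t. v t powr q) \<ge> 0" by (intro integral_nonneg vq) auto
    then show ?thesis using True \<open>a < b\<close> \<open>q \<ge> 1\<close> unfolding c_def by simp
  next
    case False
    then have "c > 0" using iv \<open>a < b\<close> unfolding c_def by (auto simp: less_le)
    let ?l = "\<lambda>t. c powr q + q * c powr (q - 1) * (v t - c)"
    have vc: "(\<lambda>t. v t - c) integrable_on {a..b}" using v by (intro integrable_diff) auto
    have "integral {a..b} ?l \<le> integral {a..b} (\<lambda>t. v t powr q)"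
      using vc by (intro integral_le integrable_add integrable_on_mult_right vq powr_tangent_le)
        (use assms \<open>c > 0\<close> in auto)
    also have "integral {a..b} ?l = (b - a) * c powr q + q * c powr (q - 1) * (integral {a..b} v - (b - a) * c)"
    proof -
      have "integral {a..b} (\<lambda>t. v t - c) = integral {a..b} v - (b - a) * c"
        using v \<open>a < b\<close> by (subst integral_diff) auto
      then show ?thesis using vc \<open>a < b\<close> by (subst integral_add) (auto intro!: integrable_on_mult_right)
    qed
    also have "integral {a..b} v - (b - a) * c = 0" using \<open>a < b\<close> by (simp add: c_def)
    finally show ?thesis using \<open>a < b\<close> unfolding c_def[symmetric] by (simp add: field_simps)
  qed
qed

lemma is_norm_steklov_powr_le:
  fixes w :: "real \<Rightarrow> 'a::euclidean_space"
  assumes N: "is_norm N" and w: "loc_int w" and "q \<ge> 1" "h > 0"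
    and wq: "(\<lambda>t. N (w t) powr q) integrable_on {t - h..t}"
  shows "N (steklov h w t) powr q \<le> 1 / h * integral {t - h..t} (\<lambda>t. N (w t) powr q)"
proof -
  have "N (steklov h w t) \<le> 1 / h * integral {t - h..t} (\<lambda>t. N (w t))"
    using is_norm_integral_le[OF N loc_int_abs[OF w]] \<open>h > 0\<close>
    by (simp add: steklov_def is_norm_scaleR[OF N] divide_right_mono)
  then have "N (steklov h w t) powr q \<le> (1 / h * integral {t - h..t} (\<lambda>t. N (w t))) powr q"
    using \<open>q \<ge> 1\<close> is_norm_nonneg[OF N] by (intro powr_mono2) auto
  also have "\<dots> \<le> 1 / h * integral {t - h..t} (\<lambda>t. N (w t) powr q)"
    using powr_average_le[of "t - h" t q "\<lambda>t. N (w t)"] assms is_norm_nonneg[OF N]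
      loc_int_integrable[OF loc_int_is_norm[OF N w]] by simp
  finally show ?thesis .
qed

text \<open>No exchange of integrals is needed. With a primitive \<open>V\<close> of
  \<open>v\<close>, the left side is the mean of \<open>V\<close> over \<open>{b-h..b}\<close> minus
  its mean over \<open>{a..a+h}\<close>, and \<open>V\<close> is increasing.\<close>

lemma integral_steklov_le:
  fixes v :: "real \<Rightarrow> real"
  assumes v: "loc_int v" and nn: "\<And>t. 0 \<le> v t" and "h > 0" "a + h \<le> b"
  shows "integral {a + h..b} (steklov h v) \<le> integral {a..b} v"
proof -
  define V where "V = (\<lambda>t. signed_integral v t)"
  have pV: "primitive V v" using primitive_signed_integral[OF v, of 0] by (simp add: V_def)
  have V: "loc_int V" by (rule primitive_loc_int[OF pV])
  have mono: "V s \<le> V t" if "s \<le> t" for s t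
    using pV that integral_nonneg[OF loc_int_integrable[OF v], of s t] nn by (auto simp: primitive_def)
  have "primitive (steklov h V) (steklov h v)" using pV \<open>h > 0\<close> by (rule primitive_steklov_steklov)
  then have "integral {a + h..b} (steklov h v) = steklov h V b - steklov h V (a + h)"
    using assms by (simp add: primitive_def)
  also have "\<dots> \<le> V b - V a"
  proof -
    have "integral {b - h..b} V \<le> integral {b - h..b} (\<lambda>_. V b)"
      using loc_int_integrable[OF V] mono by (intro integral_le) auto
    moreover have "integral {a..a + h} V \<ge> integral {a..a + h} (\<lambda>_. V a)"
      using loc_int_integrable[OF V] mono by (intro integral_le) auto
    ultimately show ?thesis using \<open>h > 0\<close>
      by (simp add: steklov_def field_simps)
  qed
  also have "\<dots> = integral {a..b} v" using pV assms by (simp add: primitive_def)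
  finally show ?thesis .
qed

lemma continuous_on_powr_is_norm:
  fixes u :: "real \<Rightarrow> 'a::euclidean_space"
  assumes "is_norm N" "continuous_on S u" "q > 0"
  shows "continuous_on S (\<lambda>t. N (u t) powr q)"
proof -
  have "continuous_on S (\<lambda>t. N (u t))"
    using continuous_on_compose2[OF is_norm_continuous[OF assms(1), of UNIV] assms(2)] by auto
  then show ?thesis using assms is_norm_nonneg by (intro continuous_on_powr' continuous_intros) auto
qed

lemma steklov_cong:
  "(\<And>s. s \<in> {t - h..t} \<Longrightarrow> u s = v s) \<Longrightarrow> steklov h u t = steklov h v t"
  unfolding steklov_def by (metis integral_cong)

lemma integral_is_norm_steklov_le:
  fixes w :: "real \<Rightarrow> 'a::euclidean_space"
  assumes N: "is_norm N" and w: "loc_int w" and "q \<ge> 1" "h > 0" "a + h \<le> b"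
    and wq: "(\<lambda>t. N (w t) powr q) integrable_on {a..b}"
  shows "(\<lambda>t. N (steklov h w t) powr q) integrable_on {a + h..b}"
    and "integral {a + h..b} (\<lambda>t. N (steklov h w t) powr q) \<le> integral {a..b} (\<lambda>t. N (w t) powr q)"
proof -
  have "continuous_on UNIV (steklov h w)" using primitive_steklov[OF w \<open>h > 0\<close>] primitive_continuous by blast
  then have "continuous_on {a + h..b} (\<lambda>t. N (steklov h w t) powr q)"
    using continuous_on_powr_is_norm[OF N _] \<open>q \<ge> 1\<close>
    by (metis continuous_on_subset less_le_trans subset_UNIV zero_less_one)
  then show i: "(\<lambda>t. N (steklov h w t) powr q) integrable_on {a + h..b}"
    by (rule integrable_continuous_real)
  \<comment> \<open>The power is integrable on \<open>{a..b}\<close> only. Its cutoff is locally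
    integrable, and no window \<open>{t - h..t}\<close> with \<open>t\<close> in
    \<open>{a + h..b}\<close> sees the cut.\<close>
  define v where "v = (\<lambda>t. if t \<in> {a..b} then N (w t) powr q else 0)"
  have "v absolutely_integrable_on UNIV"
    unfolding v_def using wq
    by (intro nonnegative_absolutely_integrable_1) (simp_all add: integrable_restrict_UNIV del: atLeastAtMost_iff)
  then have v: "loc_int v"
    unfolding loc_int_def by (meson absolutely_integrable_on_subinterval set_integrable_subset
        sets_completionI_sets sets_lborel atLeastAtMost_borel subset_UNIV)
  have "integral {a + h..b} (\<lambda>t. N (steklov h w t) powr q) \<le> integral {a + h..b} (steklov h v)"
  proof (rule integral_le[OF i])
    show "steklov h v integrable_on {a + h..b}" by (intro loc_int_integrable loc_int_steklov v \<open>h > 0\<close>)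
    fix t assume t: "t \<in> {a + h..b}"
    have "steklov h v t = steklov h (\<lambda>t. N (w t) powr q) t"
      by (rule steklov_cong) (use t in \<open>auto simp: v_def\<close>)
    moreover have "(\<lambda>t. N (w t) powr q) integrable_on {t - h..t}"
      by (rule integrable_subinterval_real[OF wq]) (use t in auto)
    ultimately show "N (steklov h w t) powr q \<le> steklov h v t"
      using is_norm_steklov_powr_le[OF N w \<open>q \<ge> 1\<close> \<open>h > 0\<close>, of t] by (simp add: steklov_def[of _ "\<lambda>t. N (w t) powr q"])
  qed
  also have "\<dots> \<le> integral {a..b} v"
    by (rule integral_steklov_le) (use v assms in \<open>auto simp: v_def\<close>)
  also have "\<dots> = integral {a..b} (\<lambda>t. N (w t) powr q)"
    by (rule integral_cong) (simp add: v_def)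
  finally show "integral {a + h..b} (\<lambda>t. N (steklov h w t) powr q) \<le> integral {a..b} (\<lambda>t. N (w t) powr q)" .
qed

lemma integral_is_norm_steklov_funpow_le:
  fixes w :: "real \<Rightarrow> 'a::euclidean_space"
  assumes N: "is_norm N" and w: "loc_int w" and "q \<ge> 1" "h > 0" "a + real k * h \<le> b"
    and wq: "(\<lambda>t. N (w t) powr q) integrable_on {a..b}"
  shows "(\<lambda>t. N ((steklov h ^^ k) w t) powr q) integrable_on {a + real k * h..b} \<and>
    integral {a + real k * h..b} (\<lambda>t. N ((steklov h ^^ k) w t) powr q) \<le> integral {a..b} (\<lambda>t. N (w t) powr q)"
  using assms(5)
proof (induction k)
  case (Suc k)
  have eq: "a + real (Suc k) * h = a + real k * h + h" by (simp add: algebra_simps)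
  with Suc.prems \<open>h > 0\<close> have IH: "(\<lambda>t. N ((steklov h ^^ k) w t) powr q) integrable_on {a + real k * h..b}"
    "integral {a + real k * h..b} (\<lambda>t. N ((steklov h ^^ k) w t) powr q) \<le> integral {a..b} (\<lambda>t. N (w t) powr q)"
    using Suc.IH by auto
  show ?case
    using integral_is_norm_steklov_le[OF N loc_int_steklov_funpow[OF w \<open>h > 0\<close>] \<open>q \<ge> 1\<close> \<open>h > 0\<close> _ IH(1)]
      IH(2) Suc.prems unfolding eq by (auto intro: order_trans)
qed (use wq in simp)

section \<open>Test functions\<close>

definition smooth :: "(real \<Rightarrow> real) \<Rightarrow> bool" where
  "smooth \<phi> \<longleftrightarrow> (\<forall>k x. (deriv ^^ k) \<phi> differentiable at x)"

text \<open>Smoothness follows from membership in any class of functions closed under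
  differentiation, so no formula for the \<open>k\<close>-th derivative is ever needed.\<close>

lemma smooth_coinduct:
  assumes "P \<phi>" "\<And>\<psi>. P \<psi> \<Longrightarrow> \<exists>\<psi>'. (\<forall>x. (\<psi> has_real_derivative \<psi>' x) (at x)) \<and> P \<psi>'"
  shows "smooth \<phi>"
proof -
  have *: "(\<forall>x. \<psi> differentiable at x) \<and> P (deriv \<psi>)" if P: "P \<psi>" for \<psi>
  proof -
    obtain \<psi>' where d: "\<And>x. (\<psi> has_real_derivative \<psi>' x) (at x)" "P \<psi>'" using assms(2)[OF P] by blast
    then have "deriv \<psi> = \<psi>'" by (auto intro: DERIV_imp_deriv)
    with d show ?thesis using real_differentiable_def by auto
  qed
  have "P ((deriv ^^ k) \<phi>)" for k by (induction k) (use assms(1) * in auto)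
  then show ?thesis using * by (simp add: smooth_def)
qed

lemma smooth_deriv: "smooth \<phi> \<Longrightarrow> smooth (deriv \<phi>)"
  unfolding smooth_def by (simp flip: funpow_swap1) (metis funpow.simps(2) comp_apply)

lemma smooth_has_deriv: "smooth \<phi> \<Longrightarrow> (\<phi> has_real_derivative deriv \<phi> x) (at x)"
  unfolding smooth_def by (metis DERIV_deriv_iff_real_differentiable funpow_0)

lemma smooth_continuous: "smooth \<phi> \<Longrightarrow> continuous_on S \<phi>"
  by (meson DERIV_isCont continuous_at_imp_continuous_on smooth_has_deriv)

lemma smooth_if_deriv:
  assumes "\<And>x. (\<Phi> has_real_derivative \<phi> x) (at x)" "smooth \<phi>" shows "smooth \<Phi>"
proof (rule smooth_coinduct[where P = "\<lambda>\<psi>. \<psi> = \<Phi> \<or> smooth \<psi>"])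
  fix \<psi> assume "\<psi> = \<Phi> \<or> smooth \<psi>"
  then show "\<exists>\<psi>'. (\<forall>x. (\<psi> has_real_derivative \<psi>' x) (at x)) \<and> (\<psi>' = \<Phi> \<or> smooth \<psi>')"
  proof
    assume "\<psi> = \<Phi>" then show ?thesis using assms by (intro exI[of _ \<phi>]) simp
  next
    assume "smooth \<psi>"
    then show ?thesis using smooth_deriv smooth_has_deriv by (intro exI[of _ "deriv \<psi>"]) simp
  qed
qed simp

lemma smooth_affine:
  assumes "smooth \<phi>" shows "smooth (\<lambda>x. \<phi> (c * x + d))"
proof (rule smooth_coinduct[where P = "\<lambda>h. \<exists>k \<psi>. smooth \<psi> \<and> h = (\<lambda>x. k * \<psi> (c * x + d))"])
  show "\<exists>k \<psi>. smooth \<psi> \<and> (\<lambda>x. \<phi> (c * x + d)) = (\<lambda>x. k * \<psi> (c * x + d))"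
    using assms by (intro exI[of _ 1] exI[of _ \<phi>]) simp
  fix h assume "\<exists>k \<psi>. smooth \<psi> \<and> h = (\<lambda>x. k * \<psi> (c * x + d))"
  then obtain k \<psi> where h: "smooth \<psi>" "h = (\<lambda>x. k * \<psi> (c * x + d))" by blast
  have "(h has_real_derivative (k * c) * deriv \<psi> (c * x + d)) (at x)" for x
    unfolding h(2) by (rule derivative_eq_intros DERIV_chain2[OF smooth_has_deriv[OF h(1)]] refl | simp)+
  then show "\<exists>h'. (\<forall>x. (h has_real_derivative h' x) (at x)) \<and> (\<exists>k \<psi>. smooth \<psi> \<and> h' = (\<lambda>x. k * \<psi> (c * x + d)))"
    using smooth_deriv[OF h(1)] by (intro exI[of _ "\<lambda>x. (k * c) * deriv \<psi> (c * x + d)"]) auto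
qed

lemma smooth_linear_combination:
  assumes "smooth \<phi>" "smooth \<psi>" shows "smooth (\<lambda>x. a * \<phi> x + b * \<psi> x)"
proof (rule smooth_coinduct[where P = "\<lambda>h. \<exists>\<phi> \<psi>. smooth \<phi> \<and> smooth \<psi> \<and> h = (\<lambda>x. a * \<phi> x + b * \<psi> x)"])
  fix h assume "\<exists>\<phi> \<psi>. smooth \<phi> \<and> smooth \<psi> \<and> h = (\<lambda>x. a * \<phi> x + b * \<psi> x)"
  then obtain \<phi> \<psi> where h: "smooth \<phi>" "smooth \<psi>" "h = (\<lambda>x. a * \<phi> x + b * \<psi> x)" by blast
  have "(h has_real_derivative a * deriv \<phi> x + b * deriv \<psi> x) (at x)" for x
    unfolding h(3) using h(1,2) by (intro DERIV_add DERIV_cmult smooth_has_deriv)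
  then show "\<exists>h'. (\<forall>x. (h has_real_derivative h' x) (at x)) \<and>
      (\<exists>\<phi> \<psi>. smooth \<phi> \<and> smooth \<psi> \<and> h' = (\<lambda>x. a * \<phi> x + b * \<psi> x))"
    using h(1,2)[THEN smooth_deriv]
    by (intro exI[of _ "\<lambda>x. a * deriv \<phi> x + b * deriv \<psi> x"]) blast
qed (use assms in blast)

text \<open>The closure of products under differentiation: the derivative of a product is a sum of
  two products. It stands in for the Leibniz formula of order \<open>k\<close>.\<close>

inductive sum_of_products :: "(real \<Rightarrow> real) \<Rightarrow> bool" where
  product: "smooth \<phi> \<Longrightarrow> smooth \<psi> \<Longrightarrow> sum_of_products (\<lambda>x. \<phi> x * \<psi> x)"
| sum: "sum_of_products \<phi> \<Longrightarrow> sum_of_products \<psi> \<Longrightarrow> sum_of_products (\<lambda>x. \<phi> x + \<psi> x)"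

lemma smooth_mult:
  assumes "smooth \<phi>" "smooth \<psi>" shows "smooth (\<lambda>x. \<phi> x * \<psi> x)"
proof (rule smooth_coinduct[where P = sum_of_products])
  show "sum_of_products (\<lambda>x. \<phi> x * \<psi> x)" using assms by (rule product)
  show "\<exists>h'. (\<forall>x. (h has_real_derivative h' x) (at x)) \<and> sum_of_products h'" if "sum_of_products h" for h
    using that
  proof induction
    case (product \<phi> \<psi>)
    have "((\<lambda>x. \<phi> x * \<psi> x) has_real_derivative (deriv \<phi> x * \<psi> x + deriv \<psi> x * \<phi> x)) (at x)" for x
      using product by (intro DERIV_mult smooth_has_deriv)
    moreover have "sum_of_products (\<lambda>x. deriv \<phi> x * \<psi> x + deriv \<psi> x * \<phi> x)"
      using product smooth_deriv by (intro sum_of_products.intros)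
    ultimately show ?case by (intro exI[of _ "\<lambda>x. deriv \<phi> x * \<psi> x + deriv \<psi> x * \<phi> x"]) simp
  next
    case (sum \<phi> \<psi>)
    then obtain \<phi>' \<psi>' where "\<And>x. (\<phi> has_real_derivative \<phi>' x) (at x)" "sum_of_products \<phi>'"
      "\<And>x. (\<psi> has_real_derivative \<psi>' x) (at x)" "sum_of_products \<psi>'" by auto
    then show ?case
      by (intro exI[of _ "\<lambda>x. \<phi>' x + \<psi>' x"] conjI allI DERIV_add sum_of_products.sum)
  qed
qed

section \<open>A smooth function that vanishes on a half-line\<close>

lemma poly_times_exp_minus_tendsto_0:
  fixes p :: "real poly"
  shows "((\<lambda>y. poly p y * exp (- y)) \<longlongrightarrow> 0) at_top"
proof -
  have "((\<lambda>y. \<Sum>i\<le>degree p. coeff p i * (y ^ i / exp y)) \<longlongrightarrow> (\<Sum>i\<le>degree p. coeff p i * 0)) at_top"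
    by (intro tendsto_intros tendsto_power_div_exp_0)
  then show ?thesis
    by (simp add: poly_altdef sum_distrib_right exp_minus divide_inverse mult.assoc)
qed

definition flat_exp :: "real \<Rightarrow> real" where
  "flat_exp x = (if x > 0 then exp (- (1 / x)) else 0)"

lemma smooth_flat_exp: "smooth flat_exp"
proof -
  \<comment> \<open>The class closed under differentiation. For \<open>x > 0\<close> the derivative
    of \<open>p (1 / x) exp (- 1 / x)\<close> is \<open>(p - p') (1 / x) / x^2\<close> times the
    same exponential, which gives the polynomial
    \<open>[:0, 0, 1:] * (p - pderiv p)\<close>.\<close>
  define F where "F = (\<lambda>(p::real poly) x::real. if x > 0 then poly p (1 / x) * exp (- (1 / x)) else 0)"
  have "(F p has_real_derivative F ([:0, 0, 1:] * (p - pderiv p)) x) (at x)" for p x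
  proof -
    consider "x > 0" | "x < 0" | "x = 0" by linarith
    then show ?thesis
    proof cases
      case 1
      have "((\<lambda>x. poly p (1 / x) * exp (- (1 / x))) has_real_derivative
        F ([:0, 0, 1:] * (p - pderiv p)) x) (at x)"
        using 1 by (auto intro!: derivative_eq_intros DERIV_chain2[OF poly_DERIV]
            simp: F_def power2_eq_square field_simps)
      then show ?thesis
        by (rule has_field_derivative_transform_within_open[where S = "{0<..}"]) (use 1 in \<open>auto simp: F_def\<close>)
    next
      case 2
      have "((\<lambda>x. 0) has_real_derivative F ([:0, 0, 1:] * (p - pderiv p)) x) (at x)"
        using 2 by (simp add: F_def)
      then show ?thesis
        by (rule has_field_derivative_transform_within_open[where S = "{..<0}"]) (use 2 in \<open>auto simp: F_def\<close>)
    next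
      case 3
      \<comment> \<open>In the variable \<open>y = 1 / h\<close>, the right difference quotient at 0
        is \<open>y p(y) exp (- y)\<close>; the factor \<open>[:0, 1:]\<close> is the division by
        \<open>h\<close>.\<close>
      have "((\<lambda>h. poly ([:0, 1:] * p) (inverse h) * exp (- inverse h)) \<longlongrightarrow> 0) (at_right 0)"
        by (rule filterlim_compose[OF poly_times_exp_minus_tendsto_0 filterlim_inverse_at_top_right])
      then have "((\<lambda>h. (F p h - F p 0) / h) \<longlongrightarrow> 0) (at_right 0)"
        by (rule Lim_transform_eventually)
          (auto simp: F_def eventually_at_filter divide_inverse mult_ac)
      moreover have "((\<lambda>h. (F p h - F p 0) / h) \<longlongrightarrow> 0) (at_left 0)"
        by (rule Lim_transform_eventually[OF tendsto_const]) (auto simp: F_def eventually_at_filter)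
      ultimately have "((\<lambda>h. (F p h - F p 0) / h) \<longlongrightarrow> 0) (at 0)"
        by (simp add: filterlim_at_split)
      then show ?thesis by (simp only: DERIV_def 3 add_0_left) (simp add: F_def)
    qed
  qed
  moreover have "flat_exp = F 1" by (auto simp: F_def flat_exp_def)
  ultimately show ?thesis
    by (intro smooth_coinduct[where P = "\<lambda>h. \<exists>p. h = F p"]) auto
qed

text \<open>Compactness of the support yields a closed interval with a margin to 0 and 1, which is
  easier to carry through constructions than a closure. Empty support is separate, as it has no
  least point; any interval does there.\<close>

lemma test_function_iff:
  "\<phi> \<in> test_functions \<longleftrightarrow> smooth \<phi> \<and> (\<exists>a b. 0 < a \<and> a \<le> b \<and> b < 1 \<and> (\<forall>x. x \<notin> {a..b} \<longrightarrow> \<phi> x = 0))"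
    (is "_ \<longleftrightarrow> _ \<and> ?supp")
proof -
  let ?S = "closure {x. \<phi> x \<noteq> 0}"
  have "?S \<subseteq> {0<..<1} \<longleftrightarrow> ?supp"
  proof
    assume S: "?S \<subseteq> {0<..<1}"
    then have "bounded ?S" by (rule bounded_subset[OF bounded_box[of "0::real" 1, unfolded box_real]])
    then have c: "compact ?S" by (simp add: compact_eq_bounded_closed)
    show ?supp
    proof (cases "?S = {}")
      case True
      then have "\<forall>x. x \<notin> {1/2..1/2} \<longrightarrow> \<phi> x = 0" by simp
      moreover have "(0::real) < 1/2" "(1/2::real) \<le> 1/2" "(1/2::real) < 1" by simp_all
      ultimately show ?thesis by blast
    next
      case False
      obtain a where a: "a \<in> ?S" "\<And>x. x \<in> ?S \<Longrightarrow> a \<le> x" using compact_attains_inf[OF c False] by blast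
      obtain b where b: "b \<in> ?S" "\<And>x. x \<in> ?S \<Longrightarrow> x \<le> b" using compact_attains_sup[OF c False] by blast
      have "x \<in> {a..b}" if "\<phi> x \<noteq> 0" for x
      proof -
        have "x \<in> ?S" using that closure_subset[of "{x. \<phi> x \<noteq> 0}"] by blast
        then show ?thesis using a(2) b(2) by simp
      qed
      moreover have "0 < a" "b < 1" using a(1) b(1) S by auto
      moreover have "a \<le> b" using a b by blast
      ultimately show ?thesis by blast
    qed
  next
    assume ?supp
    then obtain a b where ab: "0 < a" "b < 1" "\<forall>x. x \<notin> {a..b} \<longrightarrow> \<phi> x = 0" by blast
    have "?S \<subseteq> {a..b}" by (rule closure_minimal) (use ab in auto)
    also have "\<dots> \<subseteq> {0<..<1}" using ab by auto
    finally show "?S \<subseteq> {0<..<1}" .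
  qed
  then show ?thesis by (simp add: test_functions_def smooth_def)
qed

lemma test_function_deriv:
  assumes "\<phi> \<in> test_functions" shows "deriv \<phi> \<in> test_functions"
proof -
  obtain a b where ab: "smooth \<phi>" "0 < a" "a \<le> b" "b < 1" "\<And>x. x \<notin> {a..b} \<Longrightarrow> \<phi> x = 0"
    using assms unfolding test_function_iff by blast
  have "deriv \<phi> x = 0" if "x \<notin> {a..b}" for x
  proof -
    have "((\<lambda>x. 0) has_real_derivative 0) (at x)" by simp
    then have "(\<phi> has_real_derivative 0) (at x)"
      by (rule has_field_derivative_transform_within_open[where S = "- {a..b}"])
        (use that ab in \<open>auto simp: open_Compl\<close>)
    then show ?thesis by (rule DERIV_imp_deriv)
  qed
  then show ?thesis using ab smooth_deriv unfolding test_function_iff by blast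
qed

lemma test_function_deriv_funpow: "\<phi> \<in> test_functions \<Longrightarrow> (deriv ^^ k) \<phi> \<in> test_functions"
  by (induction k) (auto intro: test_function_deriv)

lemma test_function_linear_combination:
  assumes "\<phi> \<in> test_functions" "\<psi> \<in> test_functions"
  shows "(\<lambda>x. c * \<phi> x + d * \<psi> x) \<in> test_functions"
proof -
  obtain a b a' b' where "smooth \<phi>" "0 < a" "a \<le> b" "b < 1" "\<And>x. x \<notin> {a..b} \<Longrightarrow> \<phi> x = 0"
    "smooth \<psi>" "0 < a'" "a' \<le> b'" "b' < 1" "\<And>x. x \<notin> {a'..b'} \<Longrightarrow> \<psi> x = 0"
    using assms unfolding test_function_iff by blast
  note h = this
  have "c * \<phi> x + d * \<psi> x = 0" if "x \<notin> {min a a'..max b b'}" for x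
  proof -
    have "x \<notin> {a..b}" "x \<notin> {a'..b'}" using that by auto
    then show ?thesis using h(5,10) by simp
  qed
  moreover have "smooth (\<lambda>x. c * \<phi> x + d * \<psi> x)" "0 < min a a'" "min a a' \<le> max b b'" "max b b' < 1"
    using h by (simp_all add: smooth_linear_combination)
  ultimately have "smooth (\<lambda>x. c * \<phi> x + d * \<psi> x)" "0 < min a a'" "min a a' \<le> max b b'" "max b b' < 1"
    "\<forall>x. x \<notin> {min a a'..max b b'} \<longrightarrow> c * \<phi> x + d * \<psi> x = 0" by blast+
  then show ?thesis unfolding test_function_iff by blast
qed

text \<open>The primitive starting at 0 vanishes left of the support of \<phi> and equals the total
  integral right of it; zero mean makes it compactly supported.\<close>

lemma test_function_primitive:
  assumes \<phi>: "\<phi> \<in> test_functions" and "integral {0..1} \<phi> = 0"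
  obtains \<Phi> where "\<Phi> \<in> test_functions" "deriv \<Phi> = \<phi>"
proof -
  obtain a b where ab: "smooth \<phi>" "0 < a" "a \<le> b" "b < 1" "\<And>x. x \<notin> {a..b} \<Longrightarrow> \<phi> x = 0"
    using \<phi> unfolding test_function_iff by blast
  note cont = smooth_continuous[OF ab(1)]
  note i = integrable_continuous_real[OF cont]
  define \<Phi> where "\<Phi> = signed_integral \<phi>"
  have p: "primitive \<Phi> \<phi>"
    using primitive_signed_integral[OF loc_int_continuous[OF cont], of 0] by (simp add: \<Phi>_def)
  have d: "(\<Phi> has_real_derivative \<phi> x) (at x)" for x
  proof -
    have "((\<lambda>t. \<Phi> (x - 1) + integral {x - 1..t} \<phi>) has_real_derivative (0 + \<phi> x)) (at x within {x - 1..x + 1})"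
      by (intro derivative_intros integral_has_real_derivative cont) auto
    then have "((\<lambda>t. \<Phi> (x - 1) + integral {x - 1..t} \<phi>) has_real_derivative \<phi> x) (at x within {x - 1..x + 1})"
      by simp
    then have "(\<Phi> has_real_derivative \<phi> x) (at x within {x - 1..x + 1})"
      by (rule has_field_derivative_transform_within[where d = 1])
        (use p in \<open>auto simp: primitive_def\<close>)
    moreover have "at x within {x - 1..x + 1} = at x" by (rule at_within_interior) simp
    ultimately show ?thesis by simp
  qed
  have inc: "integral {s..t} \<phi> = \<Phi> t - \<Phi> s" if "s \<le> t" for s t using p that by (simp add: primitive_def)
  \<comment> \<open>Any point strictly between \<open>b\<close> and 1: \<open>{b'..1}\<close> then
    misses \<open>{a..b}\<close>, whence \<open>\<Phi> b' = \<Phi> 1 = 0\<close>.\<close>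
  define b' where "b' = (b + 1) / 2"
  have b': "b < b'" "b' < 1" using ab by (auto simp: b'_def)
  have z: "integral {s..t} \<phi> = 0" if "\<And>x. x \<in> {s..t} \<Longrightarrow> x \<notin> {a..b}" for s t
    using integral_cong[of "{s..t}" \<phi> "\<lambda>_. 0"] that ab(5) by simp
  have "\<Phi> x = 0" if "x < a" for x
    using z[of 0 x] z[of x 0] that ab by (auto simp: \<Phi>_def signed_integral_def)
  moreover have "\<Phi> x = 0" if "x > b'" for x
  proof -
    have "\<Phi> 0 = 0" by (simp add: \<Phi>_def signed_integral_def)
    then have "\<Phi> b' = 0" using inc[of 0 1] inc[of b' 1] z[of b' 1] assms(2) b' ab by simp
    then show ?thesis using inc[of b' x] z[of b' x] b' that by simp
  qed
  ultimately have "\<forall>x. x \<notin> {a..b'} \<longrightarrow> \<Phi> x = 0" by (simp add: not_le)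
  then have "\<Phi> \<in> test_functions"
  proof -
    have "smooth \<Phi>" using smooth_if_deriv[OF d ab(1)] .
    moreover have "0 < a" "a \<le> b'" "b' < 1" using ab b' by simp_all
    ultimately show ?thesis using \<open>\<forall>x. x \<notin> {a..b'} \<longrightarrow> \<Phi> x = 0\<close> unfolding test_function_iff by blast
  qed
  moreover have "deriv \<Phi> = \<phi>" using d by (auto intro: DERIV_imp_deriv)
  ultimately show ?thesis using that by blast
qed

section \<open>Weak derivatives of primitives\<close>

lemma scaleR_continuous_absolutely_integrable:
  fixes w :: "real \<Rightarrow> 'a::euclidean_space"
  assumes "continuous_on {a..b} \<phi>" "w absolutely_integrable_on {a..b}"
  shows "(\<lambda>t. \<phi> t *\<^sub>R w t) absolutely_integrable_on {a..b}"
proof (rule absolutely_integrable_bounded_measurable_product[where h = scaleR, OF _ _ _ _ assms(2)])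
  show "bilinear (scaleR :: real \<Rightarrow> 'a \<Rightarrow> 'a)" by (simp add: bilinear_conv_bounded_bilinear bounded_bilinear_scaleR)
  show "\<phi> \<in> borel_measurable (lebesgue_on {a..b})"
    using assms(1) by (intro continuous_imp_measurable_on_sets_lebesgue) auto
  show "bounded (\<phi> ` {a..b})" by (simp add: assms(1) compact_continuous_image compact_imp_bounded)
qed auto

text \<open>Over \<open>n\<close> equal pieces the bounds telescope in \<open>W\<close> to
  \<open>M (b - a) (W b - W a) / n\<close>, which tends to 0. It replaces the criterion by a
  vanishing derivative where \<open>F\<close> need not be differentiable.\<close>

lemma constant_if_increments_small:
  fixes F :: "real \<Rightarrow> 'a::real_normed_vector"
  assumes "a \<le> b"
    and F: "\<And>c d. a \<le> c \<Longrightarrow> c \<le> d \<Longrightarrow> d \<le> b \<Longrightarrow> norm (F d - F c) \<le> M * (d - c) * (W d - W c)"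
  shows "F b = F a"
proof -
  have bound: "norm (F b - F a) \<le> M * (b - a) * (W b - W a) / real n" if "n > 0" for n
  proof -
    define h where "h = (b - a) / real n"
    have h: "h \<ge> 0" using assms by (simp add: h_def)
    have "norm (F (a + real i * h) - F a) \<le> M * h * (W (a + real i * h) - W a)" if "i \<le> n" for i
      using that
    proof (induction i)
      case (Suc i)
      have "a + real (Suc i) * h \<le> b"
      proof -
        have "real (Suc i) * h \<le> real n * h" using Suc.prems h by (intro mult_right_mono) auto
        then show ?thesis using \<open>n > 0\<close> by (simp add: h_def)
      qed
      then have "norm (F (a + real (Suc i) * h) - F (a + real i * h)) \<le>
          M * h * (W (a + real (Suc i) * h) - W (a + real i * h))"
        using F[of "a + real i * h" "a + real (Suc i) * h"] h by (simp add: algebra_simps)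
      then have "norm (F (a + real (Suc i) * h) - F a) \<le>
          M * h * (W (a + real (Suc i) * h) - W (a + real i * h)) + M * h * (W (a + real i * h) - W a)"
        using Suc.IH Suc.prems
          norm_triangle_ineq[of "F (a + real (Suc i) * h) - F (a + real i * h)" "F (a + real i * h) - F a"]
        by simp
      then show ?case by (simp add: right_diff_distrib)
    qed simp
    from this[of n] \<open>n > 0\<close> show ?thesis by (simp add: h_def)
  qed
  have "(\<lambda>n. M * (b - a) * (W b - W a) / real n) \<longlonglongrightarrow> 0" by (rule lim_const_over_n)
  then have "norm (F b - F a) \<le> 0"
    by (rule tendsto_lowerbound) (use bound in \<open>auto simp: eventually_at_top_dense intro!: exI[of _ 0]\<close>)
  then show ?thesis by simp
qed

text \<open>As \<open>w\<close> is merely integrable, \<open>u\<close> need not be differentiable. Instead, the defect of the identity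
  on a subinterval \<open>I\<close> is at most a constant times \<open>\<bar>I\<bar> \<integral>\<^sub>I \<parallel>w\<parallel>\<close>, and these bounds sum to \<open>0\<close> in the limit of
  fine partitions.\<close>
lemma primitive_by_parts:
  fixes u w :: "real \<Rightarrow> 'a::euclidean_space"
  assumes uw: "primitive u w" and "a \<le> b"
    and d: "\<And>x. (\<phi> has_real_derivative \<phi>' x) (at x)" and c': "continuous_on UNIV \<phi>'"
  shows "integral {a..b} (\<lambda>t. \<phi>' t *\<^sub>R u t) = \<phi> b *\<^sub>R u b - \<phi> a *\<^sub>R u a - integral {a..b} (\<lambda>t. \<phi> t *\<^sub>R w t)"
proof -
  have w: "loc_int w" using uw by (simp add: primitive_def)
  have u: "loc_int u" by (rule primitive_loc_int[OF uw])
  have c: "continuous_on UNIV \<phi>" by (meson DERIV_isCont continuous_at_imp_continuous_on d)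
  have prod: "loc_int (\<lambda>t. f t *\<^sub>R v t)" if "continuous_on UNIV f" "loc_int v" for f and v :: "real \<Rightarrow> 'a"
    unfolding loc_int_def
    by (intro allI scaleR_continuous_absolutely_integrable loc_int_abs that continuous_on_subset[OF that(1)]) simp
  define G where "G = (\<lambda>t. \<phi>' t *\<^sub>R u t + \<phi> t *\<^sub>R w t)"
  have G: "loc_int G"
    unfolding G_def loc_int_def using prod[OF c' u] prod[OF c w] by (simp add: loc_int_def set_integral_add(1))
  \<comment> \<open>The claim is \<open>F b = F a\<close>, since the integral over
    \<open>{a..a}\<close> vanishes.\<close>
  define F where "F = (\<lambda>t. \<phi> t *\<^sub>R u t - integral {a..t} G)"
  have "bounded (\<phi>' ` {a..b})"
    by (meson c' compact_Icc compact_continuous_image compact_imp_bounded continuous_on_subset subset_UNIV)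
  then obtain L where L: "L > 0" "\<And>t. t \<in> {a..b} \<Longrightarrow> \<bar>\<phi>' t\<bar> \<le> L" by (auto simp: bounded_pos)
  have lip: "\<bar>\<phi> y - \<phi> x\<bar> \<le> L * (y - x)" if "a \<le> x" "x \<le> y" "y \<le> b" for x y
  proof -
    have "norm (\<phi> y - \<phi> x) \<le> L * norm (y - x)"
      by (rule field_differentiable_bound[of "{a..b}" \<phi> \<phi>'])
        (use d L that in \<open>auto intro: has_field_derivative_at_within\<close>)
    then show ?thesis using that by simp
  qed
  define W where "W = (\<lambda>t. integral {a..t} (\<lambda>t. norm (w t)))"
  have nw: "loc_int (\<lambda>t. norm (w t))"
    unfolding loc_int_def by (simp add: loc_int_abs[OF w] absolutely_integrable_norm[unfolded o_def])
  have "F b = F a"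
  proof (rule constant_if_increments_small[OF \<open>a \<le> b\<close>, of F "2 * L" W])
    fix x y assume xy: "a \<le> x" "x \<le> y" "y \<le> b"
    have W: "W y - W x = integral {x..y} (\<lambda>t. norm (w t))"
      using loc_int_combine[OF nw, of a x y] xy by (simp add: W_def)
    have inc: "norm (u t - u x) \<le> W y - W x" if "t \<in> {x..y}" for t
    proof -
      have "norm (u t - u x) = norm (integral {x..t} w)" using uw that by (simp add: primitive_def)
      also have "\<dots> \<le> integral {x..t} (\<lambda>t. norm (w t))"
        by (rule integral_norm_bound_integral) (use loc_int_integrable w nw in auto)
      also have "\<dots> \<le> integral {x..y} (\<lambda>t. norm (w t))"
        by (rule integral_subset_le) (use loc_int_integrable nw that in auto)
      finally show ?thesis using W by simp
    qed
    have ip: "(\<lambda>t. \<phi> t *\<^sub>R w t) integrable_on {x..y}" "(\<lambda>t. \<phi>' t *\<^sub>R u t) integrable_on {x..y}"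
      "w integrable_on {x..y}" "\<phi>' integrable_on {x..y}"
      using loc_int_integrable[OF prod[OF c w]] loc_int_integrable[OF prod[OF c' u]] loc_int_integrable[OF w]
        integrable_continuous_real[OF continuous_on_subset[OF c']] by auto
    have i1: "(\<lambda>t. (\<phi> y - \<phi> t) *\<^sub>R w t) integrable_on {x..y}"
      using integrable_diff[OF integrable_cmul[OF ip(3), of "\<phi> y"] ip(1)] by (simp add: scaleR_diff_left)
    have i2: "(\<lambda>t. \<phi>' t *\<^sub>R (u x - u t)) integrable_on {x..y}"
      using ip by (simp add: scaleR_diff_right integrable_diff integrable_on_scaleR_left)
    have e1: "integral {x..y} (\<lambda>t. (\<phi> y - \<phi> t) *\<^sub>R w t) = \<phi> y *\<^sub>R (u y - u x) - integral {x..y} (\<lambda>t. \<phi> t *\<^sub>R w t)"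
    proof -
      have "integral {x..y} w = u y - u x" using uw xy by (simp add: primitive_def)
      then show ?thesis
        using integral_diff[OF integrable_cmul[OF ip(3), of "\<phi> y"] ip(1)] by (simp add: scaleR_diff_left)
    qed
    have "(\<phi>' has_integral (\<phi> y - \<phi> x)) {x..y}"
      by (rule fundamental_theorem_of_calculus)
        (use xy d in \<open>auto simp flip: has_real_derivative_iff_has_vector_derivative intro: has_field_derivative_at_within\<close>)
    then have e2: "integral {x..y} (\<lambda>t. \<phi>' t *\<^sub>R (u x - u t)) = (\<phi> y - \<phi> x) *\<^sub>R u x - integral {x..y} (\<lambda>t. \<phi>' t *\<^sub>R u t)"
      using ip integral_unique[OF has_integral_scaleR_left[of \<phi>']]
      by (simp add: scaleR_diff_right integral_diff integrable_on_scaleR_left)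
    have "integral {x..y} G = integral {x..y} (\<lambda>t. \<phi>' t *\<^sub>R u t) + integral {x..y} (\<lambda>t. \<phi> t *\<^sub>R w t)"
      unfolding G_def using ip by (intro integral_add)
    \<comment> \<open>The mixed terms \<open>\<phi> y *\<^sub>R u x\<close> cancel. What remains
      pairs \<phi>' and \<open>w\<close> with increments: \<phi> varies by at most
      \<open>L (y - x)\<close>, and \<open>u\<close> by at most \<open>W y - W x\<close>.\<close>
    then have "F y - F x = integral {x..y} (\<lambda>t. (\<phi> y - \<phi> t) *\<^sub>R w t) + integral {x..y} (\<lambda>t. \<phi>' t *\<^sub>R (u x - u t))"
      using loc_int_combine[OF G, of a x y] xy unfolding F_def e1 e2 by (simp add: algebra_simps)
    moreover have "norm (integral {x..y} (\<lambda>t. (\<phi> y - \<phi> t) *\<^sub>R w t)) \<le> integral {x..y} (\<lambda>t. (L * (y - x)) * norm (w t))"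
    proof (rule integral_norm_bound_integral[OF i1])
      show "(\<lambda>t. (L * (y - x)) * norm (w t)) integrable_on {x..y}"
        using loc_int_integrable[OF nw] by (intro integrable_on_mult_right)
      fix t assume t: "t \<in> {x..y}"
      have "\<bar>\<phi> y - \<phi> t\<bar> \<le> L * (y - t)" using lip t xy by simp
      also have "\<dots> \<le> L * (y - x)" using t L by (intro mult_left_mono) auto
      finally show "norm ((\<phi> y - \<phi> t) *\<^sub>R w t) \<le> (L * (y - x)) * norm (w t)" by (simp add: mult_right_mono)
    qed
    moreover have "norm (integral {x..y} (\<lambda>t. \<phi>' t *\<^sub>R (u x - u t))) \<le> integral {x..y} (\<lambda>t. L * (W y - W x))"
    proof (rule integral_norm_bound_integral[OF i2])
      fix t assume t: "t \<in> {x..y}"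
      then show "norm (\<phi>' t *\<^sub>R (u x - u t)) \<le> L * (W y - W x)"
        using inc[OF t] L(2)[of t] xy L(1) by (auto simp: norm_minus_commute intro!: mult_mono)
    qed auto
    ultimately have "norm (F y - F x) \<le> L * ((y - x) * (W y - W x)) + L * ((y - x) * (W y - W x))"
      using norm_triangle_ineq[of "integral {x..y} (\<lambda>t. (\<phi> y - \<phi> t) *\<^sub>R w t)" "integral {x..y} (\<lambda>t. \<phi>' t *\<^sub>R (u x - u t))"] xy
      by (simp only: integral_mult_right W integral_const_real content_real_if if_True real_scaleR_def mult.assoc)
    then show "norm (F y - F x) \<le> 2 * L * (y - x) * (W y - W x)"
      by (simp add: algebra_simps)
  qed
  moreover have "integral {a..b} G = integral {a..b} (\<lambda>t. \<phi>' t *\<^sub>R u t) + integral {a..b} (\<lambda>t. \<phi> t *\<^sub>R w t)"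
    unfolding G_def using loc_int_integrable[OF prod[OF c' u]] loc_int_integrable[OF prod[OF c w]]
    by (intro integral_add)
  ultimately show ?thesis by (simp add: F_def algebra_simps)
qed

lemma primitive_by_parts_test:
  fixes u w :: "real \<Rightarrow> 'a::euclidean_space"
  assumes uw: "primitive u w" and \<phi>: "\<phi> \<in> test_functions"
  shows "integral {0..1} (\<lambda>t. deriv \<phi> t *\<^sub>R u t) = - integral {0..1} (\<lambda>t. \<phi> t *\<^sub>R w t)"
proof -
  have s: "smooth \<phi>" and z: "\<phi> 0 = 0" "\<phi> 1 = 0" using \<phi> unfolding test_function_iff by auto
  then show ?thesis
    using primitive_by_parts[OF uw _ smooth_has_deriv[OF s] smooth_continuous[OF smooth_deriv[OF s]], of 0 1] by simp
qed

lemma weak_deriv_primitive_chain: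
  fixes u :: "nat \<Rightarrow> real \<Rightarrow> real ^ 'd"
  assumes "\<And>j. j < r \<Longrightarrow> primitive (u j) (u (Suc j))" "loc_int (u r)"
  shows "weak_deriv r (u 0) (u r)"
  unfolding weak_deriv_def
proof (intro conjI allI impI ballI)
  fix K :: "real set" assume "compact K \<and> K \<subseteq> {0<..<1}"
  then show "u r absolutely_integrable_on K"
    by (intro set_integrable_subset[OF loc_int_abs[OF assms(2), of 0 1]])
      (auto simp: lmeasurable_compact fmeasurableD)
next
  fix \<phi> assume \<phi>: "\<phi> \<in> test_functions"
  show "integral {0..1} (\<lambda>t. (deriv ^^ r) \<phi> t *\<^sub>R u 0 t) = (- 1) ^ r *\<^sub>R integral {0..1} (\<lambda>t. \<phi> t *\<^sub>R u r t)"
    using assms(1)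
  proof (induction r arbitrary: u)
    case (Suc r)
    have "integral {0..1} (\<lambda>t. (deriv ^^ Suc r) \<phi> t *\<^sub>R u 0 t) = - integral {0..1} (\<lambda>t. (deriv ^^ r) \<phi> t *\<^sub>R u 1 t)"
      using primitive_by_parts_test[OF _ test_function_deriv_funpow[OF \<phi>]] Suc.prems[of 0] by simp
    also have "\<dots> = - ((- 1) ^ r *\<^sub>R integral {0..1} (\<lambda>t. \<phi> t *\<^sub>R u (Suc r) t))"
      using Suc.IH[of "\<lambda>j. u (Suc j)"] Suc.prems by simp
    finally show ?case by simp
  qed simp
qed

section \<open>The lemma of du Bois-Reymond\<close>

text \<open>Bumps converging to the indicator of an interval show that \<open>u\<close> has integral
  0 over every interval inside \<open>{0<..<1}\<close>; Lebesgue differentiation then gives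
  \<open>u = 0\<close> almost everywhere.\<close>

lemma fundamental_lemma:
  fixes u :: "real \<Rightarrow> 'a::euclidean_space"
  assumes u: "u absolutely_integrable_on {0..1}"
    and z: "\<And>\<phi>. \<phi> \<in> test_functions \<Longrightarrow> integral {0..1} (\<lambda>t. \<phi> t *\<^sub>R u t) = 0"
  shows "negligible {t \<in> {0..1}. u t \<noteq> 0}"
proof -
  have zero: "integral {a..b} u = 0" if ab: "0 < a" "a < b" "b < 1" for a b
  proof -
    \<comment> \<open>As \<open>k\<close> grows, \<open>flat_exp (real (Suc k) * y)\<close> tends to
      1 for \<open>y > 0\<close> and stays 0 for \<open>y \<le> 0\<close>, so the products tend to
      the indicator of \<open>{a<..<b}\<close>, bounded by 1.\<close>
    define \<phi> where "\<phi> = (\<lambda>k x. flat_exp (real (Suc k) * (x - a)) * flat_exp (real (Suc k) * (b - x)))"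
    have "smooth (\<lambda>x. flat_exp (real (Suc k) * x + (- real (Suc k) * a)) *
      flat_exp (- real (Suc k) * x + real (Suc k) * b))" for k
      by (intro smooth_mult smooth_affine smooth_flat_exp)
    then have "smooth (\<phi> k)" for k by (simp add: \<phi>_def algebra_simps)
    moreover have "\<phi> k x = 0" if "x \<notin> {a..b}" for k x
      using that by (auto simp: \<phi>_def flat_exp_def zero_less_mult_iff)
    ultimately have test: "\<phi> k \<in> test_functions" for k 
      unfolding test_function_iff using ab by (intro conjI exI[of _ a] exI[of _ b]) simp_all
    have cont: "continuous_on {0..1} (\<phi> k)" for k using test smooth_continuous unfolding test_function_iff by blast
    have "(\<lambda>k. integral {0..1} (\<lambda>t. \<phi> k t *\<^sub>R u t)) \<longlonglongrightarrow> integral {0..1} (\<lambda>t. (if t \<in> {a<..<b} then 1 else 0) *\<^sub>R u t)"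
    proof (rule dominated_convergence(2))
      show "(\<lambda>t. \<phi> k t *\<^sub>R u t) integrable_on {0..1}" for k
        using scaleR_continuous_absolutely_integrable[OF cont u] by (simp add: absolutely_integrable_on_def)
      show "(\<lambda>t. norm (u t)) integrable_on {0..1}" using u by (simp add: absolutely_integrable_on_def)
      have "\<bar>flat_exp x\<bar> \<le> 1" for x by (simp add: flat_exp_def)
      then have "\<bar>\<phi> k t\<bar> \<le> 1" for k t by (simp add: \<phi>_def abs_mult mult_le_one)
      then show "norm (\<phi> k t *\<^sub>R u t) \<le> norm (u t)" for k t by (simp add: mult_left_le_one_le)
      have lim: "(\<lambda>k. flat_exp (real (Suc k) * y)) \<longlonglongrightarrow> 1" if "y > 0" for y
      proof -
        have "(\<lambda>k. exp (- (inverse (real (Suc k)) * (1 / y)))) \<longlonglongrightarrow> exp (- (0 * (1 / y)))"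
          by (intro tendsto_intros LIMSEQ_inverse_real_of_nat)
        then show ?thesis using that by (simp add: flat_exp_def zero_less_mult_iff field_simps del: of_nat_Suc)
      qed
      show "(\<lambda>k. \<phi> k t *\<^sub>R u t) \<longlonglongrightarrow> (if t \<in> {a<..<b} then 1 else 0) *\<^sub>R u t" for t
      proof (cases "t \<in> {a<..<b}")
        case True
        then have "(\<lambda>k. \<phi> k t *\<^sub>R u t) \<longlonglongrightarrow> (1 * 1) *\<^sub>R u t"
          unfolding \<phi>_def by (intro tendsto_intros lim) auto
        then show ?thesis using True by simp
      next
        case False
        then have "\<phi> k t = 0" for k by (auto simp: \<phi>_def flat_exp_def zero_less_mult_iff)
        moreover have "(if t \<in> {a<..<b} then 1 else 0) = (0::real)" using False by (rule if_not_P)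
        ultimately show ?thesis by simp
      qed
    qed
    then have "integral {0..1} (\<lambda>t. (if t \<in> {a<..<b} then 1 else 0) *\<^sub>R u t) = 0"
      by (simp only: z[OF test]) (metis LIMSEQ_const_iff)
    moreover have "integral {0..1} (\<lambda>t. (if t \<in> {a<..<b} then 1 else 0) *\<^sub>R u t) =
        integral {0..1} (\<lambda>t. if t \<in> {a<..<b} then u t else 0)"
      by (rule integral_cong) simp
    moreover have "\<dots> = integral {a<..<b} u"
    proof -
      have "{a<..<b} \<inter> {0..1} = {a<..<b}" using ab by auto
      then show ?thesis by (simp only: integral_restrict_Int)
    qed
    ultimately show ?thesis by (simp add: integral_open_interval_real)
  qed
  define v where "v = (\<lambda>t. if t \<in> {0..1} then u t else 0)"
  have "v integrable_on UNIV"
    unfolding v_def using u by (simp only: integrable_restrict_UNIV absolutely_integrable_on_def)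
  then have "v integrable_on cbox a b" for a b
    by (rule integrable_on_subcbox[OF _ subset_UNIV])
  note v = this
  \<comment> \<open>The one-sided Lebesgue differentiation theorem, for the extension of
    \<open>u\<close> by 0.\<close>
  have "\<exists>M. negligible M \<and> (\<forall>x e. x \<notin> M \<longrightarrow> 0 < e \<longrightarrow>
      (\<exists>d>0. \<forall>h. 0 < h \<and> h < d \<longrightarrow> norm (integral {x..x + h} v /\<^sub>R h - v x) < e))"
  proof (rule integrable_ccontinuous_explicit[OF v])
    fix M assume "negligible M" and M: "\<And>x e. x \<notin> M \<Longrightarrow> 0 < e \<Longrightarrow>
      \<exists>d>0. \<forall>h. 0 < h \<and> h < d \<longrightarrow> norm (integral (cbox x (x + h *\<^sub>R One)) v /\<^sub>R h ^ DIM(real) - v x) < e"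
    then show ?thesis by (intro exI[of _ M]) simp
  qed
  then obtain M where M: "negligible M" "\<And>x e. x \<notin> M \<Longrightarrow> 0 < e \<Longrightarrow>
      \<exists>d>0. \<forall>h. 0 < h \<and> h < d \<longrightarrow> norm (integral {x..x + h} v /\<^sub>R h - v x) < e"
    by (elim exE conjE) (rule that, assumption, simp)
  have uz: "u x = 0" if x: "x \<in> {0<..<1}" "x \<notin> M" for x
  proof (rule ccontr)
    assume "u x \<noteq> 0"
    then have "\<exists>d>0. \<forall>h. 0 < h \<and> h < d \<longrightarrow> norm (integral {x..x + h} v /\<^sub>R h - v x) < norm (u x)"
      by (intro M(2) x) simp
    then obtain d where d: "d > 0" "\<forall>h. 0 < h \<and> h < d \<longrightarrow> norm (integral {x..x + h} v /\<^sub>R h - v x) < norm (u x)"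
      by blast
    define h where "h = min (d / 2) ((1 - x) / 2)"
    have h: "0 < h" "h < d" "x + h < 1" using d x by (auto simp: h_def min_def field_simps)
    have "integral {x..x + h} v = integral {x..x + h} u" by (rule integral_cong) (use x h in \<open>auto simp: v_def\<close>)
    also have "\<dots> = 0" using zero x h by simp
    finally have "integral {x..x + h} v = 0" .
    moreover have "v x = u x" using x by (simp add: v_def)
    ultimately show False using d(2) h by force
  qed
  have "t \<in> M \<union> {0, 1}" if "t \<in> {0..1}" "u t \<noteq> 0" for t
  proof (rule ccontr)
    assume "t \<notin> M \<union> {0, 1}"
    then show False using uz[of t] that by auto
  qed
  then have "{t \<in> {0..1}. u t \<noteq> 0} \<subseteq> M \<union> {0, 1}" by blast
  moreover have "negligible (M \<union> {0, 1})" using M(1) by (intro negligible_Un) auto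
  ultimately show ?thesis using negligible_subset by blast
qed

lemma ex_test_function_integral_1: "\<exists>\<psi>\<in>test_functions. integral {0..1} \<psi> = 1"
proof -
  define \<phi> where "\<phi> = (\<lambda>x. flat_exp (1 * x + (- 1 / 4)) * flat_exp ((- 1) * x + 3 / 4))"
  have "smooth \<phi>" unfolding \<phi>_def by (intro smooth_mult smooth_affine smooth_flat_exp)
  moreover have "\<phi> x = 0" if "x \<notin> {1 / 4..3 / 4}" for x using that by (auto simp: \<phi>_def flat_exp_def)
  moreover have "0 < (1 / 4 :: real)" "(1 / 4 :: real) \<le> 3 / 4" "(3 / 4 :: real) < 1" by simp_all
  ultimately have test: "\<phi> \<in> test_functions" unfolding test_function_iff by blast
  have "integral {0..1} \<phi> \<noteq> 0"
  proof
    assume "integral {0..1} \<phi> = 0"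
    then have "\<forall>x\<in>{0..1}. \<phi> x = 0"
      using integral_eq_0_iff[of 0 1 \<phi>] \<open>smooth \<phi>\<close> smooth_continuous by (auto simp: \<phi>_def flat_exp_def)
    then have "\<phi> (1 / 2) = 0" by simp
    then show False by (simp add: \<phi>_def flat_exp_def)
  qed
  then show ?thesis
    using test_function_linear_combination[OF test test, of "1 / integral {0..1} \<phi>" 0]
    by (intro bexI[of _ "\<lambda>x. 1 / integral {0..1} \<phi> * \<phi> x"]) simp_all
qed

text \<open>Fix \<psi> of integral 1. Then \<open>\<phi> - (\<integral>\<phi>) \<psi>\<close> has
  mean 0, so it is the derivative of a test function and \<open>u\<close> annihilates it. This says
  that \<phi> cannot distinguish \<open>u\<close> from the constant
  \<open>\<integral>\<psi> u\<close>.\<close>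

lemma du_Bois_Reymond:
  fixes u :: "real \<Rightarrow> 'a::euclidean_space"
  assumes u: "u absolutely_integrable_on {0..1}"
    and z: "\<And>\<phi>. \<phi> \<in> test_functions \<Longrightarrow> integral {0..1} (\<lambda>t. deriv \<phi> t *\<^sub>R u t) = 0"
  shows "\<exists>c. negligible {t \<in> {0..1}. u t \<noteq> c}"
proof -
  obtain \<psi> where \<psi>: "\<psi> \<in> test_functions" "integral {0..1} \<psi> = 1" using ex_test_function_integral_1 by blast
  have prod: "(\<lambda>t. \<phi> t *\<^sub>R u t) integrable_on {0..1}" "\<phi> integrable_on {0..1}" if "\<phi> \<in> test_functions" for \<phi>
    using scaleR_continuous_absolutely_integrable[OF _ u] that smooth_continuous integrable_continuous_real
    unfolding test_function_iff absolutely_integrable_on_def by blast+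
  define c where "c = integral {0..1} (\<lambda>t. \<psi> t *\<^sub>R u t)"
  have "negligible {t \<in> {0..1}. u t - c \<noteq> 0}"
  proof (rule fundamental_lemma)
    show "(\<lambda>t. u t - c) absolutely_integrable_on {0..1}" using u by (intro set_integral_diff(1)) auto
    fix \<phi> assume \<phi>: "\<phi> \<in> test_functions"
    define k where "k = integral {0..1} \<phi>"
    have "(\<lambda>x. 1 * \<phi> x + (- k) * \<psi> x) \<in> test_functions" using \<phi> \<psi> by (intro test_function_linear_combination)
    moreover have "integral {0..1} (\<lambda>x. 1 * \<phi> x + (- k) * \<psi> x) = 0"
      using prod(2)[OF \<phi>] prod(2)[OF \<psi>(1)] \<psi>(2)
      by (simp add: integral_diff integrable_on_mult_right k_def)
    ultimately obtain \<Phi> where \<Phi>: "\<Phi> \<in> test_functions" "deriv \<Phi> = (\<lambda>x. 1 * \<phi> x + (- k) * \<psi> x)"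
      using test_function_primitive by metis
    have "0 = integral {0..1} (\<lambda>t. \<phi> t *\<^sub>R u t - k *\<^sub>R \<psi> t *\<^sub>R u t)"
      using z[OF \<Phi>(1)] by (simp add: \<Phi>(2) scaleR_diff_left)
    also have "\<dots> = integral {0..1} (\<lambda>t. \<phi> t *\<^sub>R u t) - k *\<^sub>R c"
      using integral_diff[OF prod(1)[OF \<phi>] integrable_cmul[OF prod(1)[OF \<psi>(1)], of k]]
        integral_cmul[of "{0..1}" k "\<lambda>t. \<psi> t *\<^sub>R u t"] unfolding c_def by simp
    also have "\<dots> = integral {0..1} (\<lambda>t. \<phi> t *\<^sub>R (u t - c))"
    proof -
      have "((\<lambda>t. \<phi> t *\<^sub>R c) has_integral k *\<^sub>R c) {0..1}"
        unfolding k_def by (intro has_integral_scaleR_left integrable_integral prod \<phi>)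
      from has_integral_diff[OF integrable_integral[OF prod(1)[OF \<phi>]] this] show ?thesis
        by (simp add: scaleR_diff_right integral_unique)
    qed
    finally show "integral {0..1} (\<lambda>t. \<phi> t *\<^sub>R (u t - c)) = 0" by simp
  qed
  then show ?thesis by auto
qed

section \<open>Absolutely continuous representatives\<close>

lemma is_norm_ge_norm:
  fixes N :: "'a::euclidean_space \<Rightarrow> real"
  assumes N: "is_norm N" obtains C where "C > 0" "\<And>x. norm x \<le> C * N x"
proof -
  have "sphere (0::'a) 1 \<noteq> {}" by simp
  then obtain x0 where x0: "x0 \<in> sphere 0 1" "\<And>y. y \<in> sphere 0 1 \<Longrightarrow> N x0 \<le> N y"
    using continuous_attains_inf[OF compact_sphere _ is_norm_continuous[OF N]] by metis
  have pos: "N x0 > 0"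
  proof -
    have "x0 \<noteq> 0" using x0(1) by auto
    then have "N x0 \<noteq> 0" using N by (simp add: is_norm_def)
    then show ?thesis using is_norm_nonneg[OF N, of x0] by simp
  qed
  have "norm x \<le> 1 / N x0 * N x" for x
  proof (cases "x = 0")
    case False
    then have "(1 / norm x) *\<^sub>R x \<in> sphere 0 1" by simp
    then have "N x0 \<le> 1 / norm x * N x" using x0(2) is_norm_scaleR[OF N, of "1 / norm x" x] by fastforce
    then show ?thesis using False pos by (simp add: field_simps)
  qed (simp add: is_norm_zero[OF N])
  then show ?thesis using that[of "1 / N x0"] pos by simp
qed

text \<open>Weak derivatives are assumed integrable only on compact subsets of
  \<open>{0<..<1}\<close>, while du Bois-Reymond needs integrability up to the endpoints. The bound
  \<open>N x \<le> 1 + N x powr q\<close> dominates the truncations to an exhaustion of the open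
  interval.\<close>

lemma absolutely_integrable_if_powr_integrable:
  fixes g :: "real \<Rightarrow> 'a::euclidean_space"
  assumes N: "is_norm N" and "q \<ge> 1"
    and loc: "\<And>K. compact K \<Longrightarrow> K \<subseteq> {0<..<1} \<Longrightarrow> g absolutely_integrable_on K"
    and gq: "(\<lambda>t. N (g t) powr q) integrable_on {0..1}"
  shows "g absolutely_integrable_on {0..1}"
proof -
  obtain C where C: "C > 0" "\<And>x. norm x \<le> C * N x" using is_norm_ge_norm[OF N] by blast
  define K where "K k = {1 / real (k + 2)..1 - 1 / real (k + 2)}" for k
  have K: "compact (K k)" "K k \<subseteq> {0<..<1}" for k
  proof -
    have "1 / real (k + 2) > 0" by simp
    then show "compact (K k)" "K k \<subseteq> {0<..<1}" unfolding K_def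
      by (simp, intro subsetI, unfold atLeastAtMost_iff greaterThanLessThan_iff, linarith)
  qed
  have "g absolutely_integrable_on {0<..<1}"
  proof (rule dominated_convergence_absolutely_integrable)
    fix k
    have "g absolutely_integrable_on K k" using loc K by blast
    then have "(\<lambda>t. if t \<in> K k then g t else 0) absolutely_integrable_on UNIV"
      by (simp only: absolutely_integrable_restrict_UNIV)
    then show "(\<lambda>t. if t \<in> K k then g t else 0) absolutely_integrable_on {0<..<1}"
      by (rule set_integrable_subset) auto
  next
    have "(\<lambda>t. C * (1 + N (g t) powr q)) integrable_on {0..1}"
      using gq by (intro integrable_on_mult_right integrable_add) auto
    then show "(\<lambda>t. C * (1 + N (g t) powr q)) integrable_on {0<..<1}"
      by (simp only: integrable_on_Icc_iff_Ioo)
  next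
    fix t
    have "N (g t) \<le> 1 + N (g t) powr q"
    proof (cases "N (g t) \<le> 1")
      case True
      then show ?thesis by (smt (verit) powr_ge_zero)
    next
      case False
      then have "N (g t) powr 1 \<le> N (g t) powr q" using \<open>q \<ge> 1\<close> by (intro powr_mono) auto
      then show ?thesis using False by simp
    qed
    then show "norm (g t) \<le> C * (1 + N (g t) powr q)" using C by (smt (verit) mult_left_mono)
  next
    fix t :: real assume t: "t \<in> {0<..<1}"
    have "(\<lambda>k. 1 / real (k + 2)) \<longlonglongrightarrow> 0"
      using LIMSEQ_ignore_initial_segment[OF lim_const_over_n[of 1], of 2] by simp
    moreover have "min t (1 - t) > 0" using t by simp
    ultimately have "\<forall>\<^sub>F k in sequentially. 1 / real (k + 2) < min t (1 - t)" by (rule order_tendstoD)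
    then have "\<forall>\<^sub>F k in sequentially. (if t \<in> K k then g t else 0) = g t"
      by eventually_elim (simp add: K_def)
    then show "(\<lambda>k. if t \<in> K k then g t else 0) \<longlonglongrightarrow> g t" by (rule tendsto_eventually)
  qed
  then show ?thesis by (simp only: absolutely_integrable_on_Icc_iff_Ioo)
qed

text \<open>Subtracting a primitive of \<open>w\<close> from \<open>g\<close> leaves a function with
  zero weak derivative, hence almost everywhere a constant, and this constant fixes the choice of
  primitive.\<close>

lemma primitive_representative:
  fixes g h :: "real \<Rightarrow> 'a::euclidean_space"
  assumes g: "g absolutely_integrable_on {0..1}" and w: "loc_int w"
    and wh: "negligible {t \<in> {0..1}. h t \<noteq> w t}"
    and weak: "\<And>\<phi>. \<phi> \<in> test_functions \<Longrightarrow>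
      integral {0..1} (\<lambda>t. deriv \<phi> t *\<^sub>R g t) = - integral {0..1} (\<lambda>t. \<phi> t *\<^sub>R h t)"
  shows "\<exists>u. primitive u w \<and> negligible {t \<in> {0..1}. g t \<noteq> u t}"
proof -
  define U where "U = signed_integral w"
  have U: "primitive U w" using primitive_signed_integral[OF w, of 0] by (simp add: U_def)
  have "\<exists>c. negligible {t \<in> {0..1}. g t - U t \<noteq> c}"
  proof (rule du_Bois_Reymond)
    show "(\<lambda>t. g t - U t) absolutely_integrable_on {0..1}"
      by (intro set_integral_diff(1) g loc_int_abs primitive_loc_int[OF U])
    fix \<phi> assume \<phi>: "\<phi> \<in> test_functions"
    have c: "continuous_on {0..1} (deriv \<phi>)"
      using test_function_deriv[OF \<phi>] smooth_continuous unfolding test_function_iff by blast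
    have "(\<lambda>t. deriv \<phi> t *\<^sub>R g t) integrable_on {0..1}" "(\<lambda>t. deriv \<phi> t *\<^sub>R U t) integrable_on {0..1}"
      using scaleR_continuous_absolutely_integrable[OF c g]
        scaleR_continuous_absolutely_integrable[OF c loc_int_abs[OF primitive_loc_int[OF U]]]
      by (simp_all add: absolutely_integrable_on_def)
    then have "integral {0..1} (\<lambda>t. deriv \<phi> t *\<^sub>R (g t - U t)) =
        - integral {0..1} (\<lambda>t. \<phi> t *\<^sub>R h t) + integral {0..1} (\<lambda>t. \<phi> t *\<^sub>R w t)"
      by (simp add: scaleR_diff_right integral_diff weak[OF \<phi>] primitive_by_parts_test[OF U \<phi>])
    also have "integral {0..1} (\<lambda>t. \<phi> t *\<^sub>R h t) = integral {0..1} (\<lambda>t. \<phi> t *\<^sub>R w t)"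
      by (rule integral_spike[OF wh]) auto
    finally show "integral {0..1} (\<lambda>t. deriv \<phi> t *\<^sub>R (g t - U t)) = 0" by simp
  qed
  then obtain c where c: "negligible {t \<in> {0..1}. g t - U t \<noteq> c}" by blast
  have "{t \<in> {0..1}. g t \<noteq> c + U t} = {t \<in> {0..1}. g t - U t \<noteq> c}" by (auto simp: algebra_simps)
  then show ?thesis using c primitive_signed_integral[OF w, of c]
    by (intro exI[of _ "\<lambda>t. c + U t"]) (simp add: U_def)
qed

text \<open>Built from the top order downwards: each representative must be a primitive of the
  representative already chosen for the next order. Only the top function is cut off outside
  \<open>{0..1}\<close>; the others extend by integration.\<close>

lemma primitive_chain_representative:
  fixes g :: "nat \<Rightarrow> real \<Rightarrow> 'a::euclidean_space"
  assumes "\<And>j. j \<le> m \<Longrightarrow> g j absolutely_integrable_on {0..1}"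
    and "\<And>j \<phi>. j < m \<Longrightarrow> \<phi> \<in> test_functions \<Longrightarrow>
      integral {0..1} (\<lambda>t. deriv \<phi> t *\<^sub>R g j t) = - integral {0..1} (\<lambda>t. \<phi> t *\<^sub>R g (Suc j) t)"
  shows "\<exists>u. (\<forall>j<m. primitive (u j) (u (Suc j))) \<and> loc_int (u m) \<and>
    (\<forall>j\<le>m. negligible {t \<in> {0..1}. g j t \<noteq> u j t})"
  using assms
proof (induction m arbitrary: g)
  case 0
  have "(\<lambda>t. if t \<in> {0..1} then g 0 t else 0) absolutely_integrable_on UNIV"
    using 0(1)[of 0] by (simp only: absolutely_integrable_restrict_UNIV order_refl)
  then have "loc_int (\<lambda>t. if t \<in> {0..1} then g 0 t else 0)"
    unfolding loc_int_def by (auto intro: set_integrable_subset)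
  moreover have "{t \<in> {0..1}. g 0 t \<noteq> (if t \<in> {0..1} then g 0 t else 0)} = {}" by auto
  ultimately show ?case
    by (intro exI[of _ "\<lambda>j t. if t \<in> {0..1} then g 0 t else 0"]) (simp del: atLeastAtMost_iff)
next
  case (Suc m)
  have "\<exists>u. (\<forall>j<m. primitive (u j) (u (Suc j))) \<and> loc_int (u m) \<and>
    (\<forall>j\<le>m. negligible {t \<in> {0..1}. g (Suc j) t \<noteq> u j t})"
    by (rule Suc.IH) (use Suc.prems in auto)
  then obtain u where u: "\<forall>j<m. primitive (u j) (u (Suc j))" "loc_int (u m)"
    "\<forall>j\<le>m. negligible {t \<in> {0..1}. g (Suc j) t \<noteq> u j t}" by blast
  have "loc_int (u 0)" using u(1,2) primitive_loc_int by (cases "m = 0") auto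
  then have "\<exists>v. primitive v (u 0) \<and> negligible {t \<in> {0..1}. g 0 t \<noteq> v t}"
    by (rule primitive_representative[where h = "g 1", rotated]) (use Suc.prems u(3) in auto)
  then obtain v where v: "primitive v (u 0)" "negligible {t \<in> {0..1}. g 0 t \<noteq> v t}" by blast
  let ?v = "\<lambda>j. case j of 0 \<Rightarrow> v | Suc i \<Rightarrow> u i"
  have "primitive (?v j) (?v (Suc j))" if "j < Suc m" for j using that u(1) v(1) by (cases j) auto
  moreover have "negligible {t \<in> {0..1}. g j t \<noteq> ?v j t}" if "j \<le> Suc m" for j
    using that u(3) v(2) by (cases j) auto
  ultimately show ?case using u(2) by (intro exI[of _ ?v]) simp
qed

lemma sobolev_multiball_chain:
  fixes f :: "real \<Rightarrow> real ^ 'd"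
  assumes N: "is_norm N" and "q \<ge> 1" and f: "f \<in> sobolev_multiball N m q \<alpha>"
  obtains u where "\<forall>j<m. primitive (u j) (u (Suc j))" "loc_int (u m)"
    "negligible {t \<in> {0..1}. f t \<noteq> u 0 t}"
    "\<forall>r\<le>m. (\<lambda>t. N (u r t) powr q) integrable_on {0..1} \<and> Lq_norm N q (u r) \<le> \<alpha> r"
proof -
  have fi: "f absolutely_integrable_on {0..1}" using f by (simp add: sobolev_multiball_def)
  have "\<forall>r. \<exists>g. r \<le> m \<longrightarrow> weak_deriv r f g \<and>
      (\<lambda>t. N (g t) powr q) absolutely_integrable_on {0..1} \<and> Lq_norm N q g \<le> \<alpha> r"
    using f by (auto simp: sobolev_multiball_def)
  then obtain g where g: "\<forall>r. r \<le> m \<longrightarrow> weak_deriv r f (g r) \<and>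
      (\<lambda>t. N (g r t) powr q) absolutely_integrable_on {0..1} \<and> Lq_norm N q (g r) \<le> \<alpha> r"
    by (rule exE[OF choice])
  have gq: "(\<lambda>t. N (g r t) powr q) integrable_on {0..1}" if "r \<le> m" for r
    using g that by (simp add: absolutely_integrable_on_def)
  have weak: "integral {0..1} (\<lambda>t. (deriv ^^ r) \<phi> t *\<^sub>R f t) = (- 1) ^ r *\<^sub>R integral {0..1} (\<lambda>t. \<phi> t *\<^sub>R g r t)"
    if "r \<le> m" "\<phi> \<in> test_functions" for r \<phi>
    using g that by (simp add: weak_deriv_def)
  have gi: "g r absolutely_integrable_on {0..1}" if "r \<le> m" for r
    by (rule absolutely_integrable_if_powr_integrable[OF N \<open>q \<ge> 1\<close> _ gq[OF that]])
      (use g that in \<open>simp add: weak_deriv_def\<close>)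
  have "integral {0..1} (\<lambda>t. deriv \<phi> t *\<^sub>R g j t) = - integral {0..1} (\<lambda>t. \<phi> t *\<^sub>R g (Suc j) t)"
    if j: "j < m" and \<phi>: "\<phi> \<in> test_functions" for j \<phi>
  proof -
    \<comment> \<open>The definition relates every order to \<open>f\<close> alone. Testing order
      \<open>j\<close> with \<open>deriv \<phi>\<close> and order \<open>Suc j\<close> with \<phi>
      gives the same integral against \<open>f\<close>, which links consecutive orders.\<close>
    have "(- 1) ^ j *\<^sub>R integral {0..1} (\<lambda>t. deriv \<phi> t *\<^sub>R g j t) =
        (- 1) ^ Suc j *\<^sub>R integral {0..1} (\<lambda>t. \<phi> t *\<^sub>R g (Suc j) t)"
      using weak[of j "deriv \<phi>"] weak[of "Suc j" \<phi>] test_function_deriv[OF \<phi>] j \<phi>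
      unfolding funpow_Suc_right o_apply by simp
    then have "(- 1) ^ j *\<^sub>R (- 1) ^ j *\<^sub>R integral {0..1} (\<lambda>t. deriv \<phi> t *\<^sub>R g j t) =
        (- 1) ^ j *\<^sub>R (- 1) ^ Suc j *\<^sub>R integral {0..1} (\<lambda>t. \<phi> t *\<^sub>R g (Suc j) t)"
      by (rule arg_cong)
    then show ?thesis by (simp flip: power_mult_distrib)
  qed
  from primitive_chain_representative[of m g, OF gi this]
  obtain u where u: "\<forall>j<m. primitive (u j) (u (Suc j))" "loc_int (u m)"
    "\<forall>j\<le>m. negligible {t \<in> {0..1}. g j t \<noteq> u j t}" by blast
  \<comment> \<open>The weak derivative of order 0 need not be \<open>f\<close> itself, but it
    agrees with \<open>f\<close> almost everywhere.\<close>
  have "negligible {t \<in> {0..1}. f t - g 0 t \<noteq> 0}"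
  proof (rule fundamental_lemma)
    show "(\<lambda>t. f t - g 0 t) absolutely_integrable_on {0..1}"
      by (intro set_integral_diff(1) fi gi) simp
    fix \<phi> assume \<phi>: "\<phi> \<in> test_functions"
    have c: "continuous_on {0..1} \<phi>" using \<phi> smooth_continuous unfolding test_function_iff by blast
    have "(\<lambda>t. \<phi> t *\<^sub>R f t) integrable_on {0..1}" "(\<lambda>t. \<phi> t *\<^sub>R g 0 t) integrable_on {0..1}"
      using scaleR_continuous_absolutely_integrable[OF c fi]
        scaleR_continuous_absolutely_integrable[OF c gi[of 0]]
      by (simp_all add: absolutely_integrable_on_def)
    then show "integral {0..1} (\<lambda>t. \<phi> t *\<^sub>R (f t - g 0 t)) = 0"
      using weak[OF _ \<phi>, of 0] by (simp add: scaleR_diff_right integral_diff)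
  qed
  moreover have "negligible {t \<in> {0..1}. g 0 t \<noteq> u 0 t}" using u(3) by simp
  ultimately have "negligible ({t \<in> {0..1}. f t - g 0 t \<noteq> 0} \<union> {t \<in> {0..1}. g 0 t \<noteq> u 0 t})"
    by (rule negligible_Un)
  then have "negligible {t \<in> {0..1}. f t \<noteq> u 0 t}" by (rule negligible_subset) auto
  moreover have "(\<lambda>t. N (u r t) powr q) integrable_on {0..1}" "Lq_norm N q (u r) \<le> \<alpha> r" if "r \<le> m" for r
  proof -
    have n: "negligible {t \<in> {0..1}. g r t \<noteq> u r t}" using u(3) that by blast
    show "(\<lambda>t. N (u r t) powr q) integrable_on {0..1}"
      by (rule integrable_spike[OF gq[OF that] n]) auto
    have "integral {0..1} (\<lambda>t. N (u r t) powr q) = integral {0..1} (\<lambda>t. N (g r t) powr q)"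
      by (rule integral_spike[OF n]) auto
    then show "Lq_norm N q (u r) \<le> \<alpha> r" using g that by (simp add: Lq_norm_def)
  qed
  ultimately show ?thesis using u(1,2) by (intro that[of u]) simp_all
qed

section \<open>From Sobolev functions to splines\<close>

lemma discrete_deriv_0 [simp]: "discrete_deriv 0 p i = p i"
  by (simp add: discrete_deriv_def)

text \<open>Pascal's rule on the coefficients; it matches the binomial formula with iterated
  difference quotients.\<close>

lemma discrete_deriv_Suc:
  "discrete_deriv (Suc r) p i = discrete_deriv r p i - discrete_deriv r p (i - 1)"
proof -
  define a where "a = (\<lambda>j. p (i - int j))"
  have "discrete_deriv (Suc r) p i = a 0 + (\<Sum>j = 0..r. ((-1) ^ Suc j * real (Suc r choose Suc j)) *\<^sub>R a (Suc j))"
    unfolding discrete_deriv_def a_def by (subst sum.atLeast0_atMost_Suc_shift) (simp add: o_def)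
  also have "(\<Sum>j = 0..r. ((-1) ^ Suc j * real (Suc r choose Suc j)) *\<^sub>R a (Suc j)) =
      (\<Sum>j = 0..r. ((-1) ^ Suc j * real (r choose Suc j)) *\<^sub>R a (Suc j)) - (\<Sum>j = 0..r. ((-1) ^ j * real (r choose j)) *\<^sub>R a (Suc j))"
    unfolding sum_subtractf[symmetric] by (rule sum.cong) (simp_all add: algebra_simps)
  also have "(\<Sum>j = 0..r. ((-1) ^ j * real (r choose j)) *\<^sub>R a (Suc j)) = discrete_deriv r p (i - 1)"
    unfolding discrete_deriv_def a_def by (simp add: algebra_simps)
  also have "a 0 + ((\<Sum>j = 0..r. ((-1) ^ Suc j * real (r choose Suc j)) *\<^sub>R a (Suc j)) - discrete_deriv r p (i - 1)) =
      (\<Sum>j = 0..Suc r. ((-1) ^ j * real (r choose j)) *\<^sub>R a j) - discrete_deriv r p (i - 1)"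
    by (subst sum.atLeast0_atMost_Suc_shift) (simp add: o_def)
  also have "(\<Sum>j = 0..Suc r. ((-1) ^ j * real (r choose j)) *\<^sub>R a j) = discrete_deriv r p i"
    by (simp add: discrete_deriv_def a_def)
  finally show ?thesis .
qed

lemma discrete_deriv_cong:
  "(\<And>j. i - int r \<le> j \<Longrightarrow> j \<le> i \<Longrightarrow> p j = p' j) \<Longrightarrow> discrete_deriv r p i = discrete_deriv r p' i"
  unfolding discrete_deriv_def by (intro sum.cong) auto

text \<open>The offset \<open>c\<close> serves two grids: \<open>c = h\<close> for the cell
  averages, and the position of \<open>t\<close> inside its cell for splines at arbitrary
  \<open>t\<close>.\<close>

lemma diff_quot_funpow_discrete:
  fixes w :: "real \<Rightarrow> real ^ 'd"
  assumes "\<And>i. p i = w (real_of_int i * h + c)"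
  shows "(diff_quot h ^^ r) w (real_of_int i * h + c) = (1 / h) ^ r *\<^sub>R discrete_deriv r p i"
proof (induction r arbitrary: i)
  case (Suc r)
  have "real_of_int i * h + c - h = real_of_int (i - 1) * h + c" by (simp add: algebra_simps)
  with Suc.IH[of "i - 1"] have "(diff_quot h ^^ r) w (real_of_int i * h + c - h) = (1 / h) ^ r *\<^sub>R discrete_deriv r p (i - 1)"
    by (simp only:)
  then show ?case
    by (simp add: diff_quot_def[of h "(diff_quot h ^^ r) w"] Suc.IH discrete_deriv_Suc scaleR_diff_right)
qed (use assms in simp)

lemma discrete_norm_eq:
  fixes D :: "nat \<Rightarrow> real ^ 'd"
  assumes N: "is_norm N" and "q \<ge> 1"
  shows "real n ^ r * (\<Sum>i\<in>I. 1 / real n * N (D i) powr q) powr (1 / q) =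
    (\<Sum>i\<in>I. 1 / real n * N (real n ^ r *\<^sub>R D i) powr q) powr (1 / q)"
proof -
  have "(\<Sum>i\<in>I. 1 / real n * N (real n ^ r *\<^sub>R D i) powr q) = (real n ^ r) powr q * (\<Sum>i\<in>I. 1 / real n * N (D i) powr q)"
    unfolding sum_distrib_left
    by (rule sum.cong) (simp_all add: is_norm_scaleR[OF N] powr_mult is_norm_nonneg[OF N])
  moreover have "(\<Sum>i\<in>I. 1 / real n * N (D i) powr q) \<ge> 0" by (intro sum_nonneg) simp
  ultimately show ?thesis using \<open>q \<ge> 1\<close> by (simp add: powr_mult powr_powr)
qed

section \<open>Decomposition into cells and distance of averages from point values\<close>

lemma floor_on_cell:
  assumes "n \<ge> 1" "real i * (1 / real n) < t" "t < real (Suc i) * (1 / real n)"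
  shows "\<lfloor>real n * t\<rfloor> = int i"
proof -
  have "real i < real n * t" "real n * t < real (Suc i)"
    using assms by (simp_all add: field_simps)
  then show ?thesis by (simp add: floor_eq_iff)
qed

lemma has_integral_cells:
  fixes G :: "real \<Rightarrow> 'a::banach"
  assumes "r \<le> n" "h \<ge> 0"
    and "\<And>i. r \<le> i \<Longrightarrow> i < n \<Longrightarrow> (G has_integral I i) {real i * h..real (Suc i) * h}"
  shows "(G has_integral (\<Sum>i = r..<n. I i)) {real r * h..real n * h}"
  using assms(1,3)
proof (induction n rule: dec_induct)
  case (step n)
  have "(G has_integral (\<Sum>i = r..<n. I i) + I n) {real r * h..real (Suc n) * h}"
    by (rule has_integral_combine[where c = "real n * h"])
      (use step assms(2) in \<open>auto intro: mult_right_mono\<close>)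
  then show ?case using step by simp
qed (use has_integral_refl in auto)

lemma steklov_close:
  fixes u :: "real \<Rightarrow> 'a::euclidean_space"
  assumes N: "is_norm N" and u: "loc_int u" and "h > 0"
    and B: "\<And>x. x \<in> {t - h..t} \<Longrightarrow> N (u x - c) \<le> B"
  shows "N (steklov h u t - c) \<le> B"
proof -
  have uc: "loc_int (\<lambda>x. u x - c)" by (intro loc_int_diff u loc_int_continuous) simp
  have "steklov h (\<lambda>x. u x - c) t = steklov h u t - c"
    using integral_diff[OF loc_int_integrable[OF u, of "t - h" t] integrable_const_ivl[of c]] \<open>h > 0\<close>
    by (simp add: steklov_def scaleR_diff_right)
  then have "N (steklov h u t - c) = 1 / h * N (integral {t - h..t} (\<lambda>x. u x - c))"
    using \<open>h > 0\<close> by (metis (no_types, lifting) abs_of_nonneg divide_nonneg_pos is_norm_scaleR[OF N] steklov_def zero_le_one)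
  also have "\<dots> \<le> 1 / h * integral {t - h..t} (\<lambda>x. N (u x - c))"
    using is_norm_integral_le[OF N loc_int_abs[OF uc]] \<open>h > 0\<close> by (intro mult_left_mono) auto
  also have "integral {t - h..t} (\<lambda>x. N (u x - c)) \<le> integral {t - h..t} (\<lambda>_. B)"
    using loc_int_integrable[OF loc_int_is_norm[OF N uc]] B by (intro integral_le) auto
  finally show ?thesis using \<open>h > 0\<close> by (simp add: mult_left_mono divide_right_mono)
qed

lemma steklov_funpow_close:
  fixes u :: "real \<Rightarrow> 'a::euclidean_space"
  assumes N: "is_norm N" and u: "loc_int u" and "h > 0"
    and "\<And>x. x \<in> {t - real k * h..t} \<Longrightarrow> N (u x - c) \<le> B"
  shows "N ((steklov h ^^ k) u t - c) \<le> B"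
  using assms(4)
proof (induction k arbitrary: t)
  case (Suc k)
  have "N ((steklov h ^^ k) u x - c) \<le> B" if "x \<in> {t - h..t}" for x
    by (rule Suc.IH, rule Suc.prems) (use that in \<open>auto simp: algebra_simps\<close>)
  then show ?case using steklov_close[OF N loc_int_steklov_funpow[OF u \<open>h > 0\<close>] \<open>h > 0\<close>] by simp
qed simp

lemma primitive_is_norm_diff_le:
  fixes u :: "real \<Rightarrow> 'a::euclidean_space"
  assumes N: "is_norm N" and uw: "primitive u w" and "x \<in> {a..b}" "t \<in> {a..b}"
  shows "N (u x - u t) \<le> integral {a..b} (\<lambda>s. N (w s))"
proof -
  have *: "N (u y - u x) \<le> integral {a..b} (\<lambda>s. N (w s))" if "a \<le> x" "x \<le> y" "y \<le> b" for x y
  proof -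
    have w: "loc_int w" using uw by (simp add: primitive_def)
    have "N (u y - u x) = N (integral {x..y} w)" using uw that by (simp add: primitive_def)
    also have "\<dots> \<le> integral {x..y} (\<lambda>s. N (w s))" by (rule is_norm_integral_le[OF N loc_int_abs[OF w]]) simp
    also have "\<dots> \<le> integral {a..b} (\<lambda>s. N (w s))"
      using loc_int_integrable[OF loc_int_is_norm[OF N w]] that is_norm_nonneg[OF N] by (intro integral_subset_le) auto
    finally show ?thesis .
  qed
  show ?thesis
  proof (cases "x \<le> t")
    case True then show ?thesis using *[of x t] assms(3,4) is_norm_commute[OF N, of "u x" "u t"] by simp
  next
    case False then show ?thesis using *[of t x] assms(3,4) by simp
  qed
qed

text \<open>Jensen's inequality leaves the factor \<open>(b - a) powr (q - 1)\<close>, at most 1 on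
  an interval of length at most 1. This keeps \<open>q\<close> out of the final constant.\<close>

lemma integral_le_Lq:
  fixes v :: "real \<Rightarrow> real"
  assumes "a < b" "b \<le> a + 1" "q \<ge> 1" and v: "v integrable_on {a..b}"
    and vq: "(\<lambda>t. v t powr q) integrable_on {a..b}" and nn: "\<And>t. t \<in> {a..b} \<Longrightarrow> 0 \<le> v t"
  shows "integral {a..b} v \<le> (integral {a..b} (\<lambda>t. v t powr q)) powr (1 / q)"
proof -
  let ?l = "b - a" and ?I = "integral {a..b} v" and ?Q = "integral {a..b} (\<lambda>t. v t powr q)"
  have I: "0 \<le> ?I" using nn v by (intro integral_nonneg) auto
  have "?I powr q = ?l powr q * (1 / ?l * ?I) powr q" using assms I by (simp flip: powr_mult)
  also have "\<dots> \<le> ?l powr q * (1 / ?l * ?Q)"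
    using powr_average_le[OF \<open>a < b\<close> \<open>q \<ge> 1\<close> v vq nn] by (intro mult_left_mono) auto
  also have "\<dots> = ?l powr (q - 1) * ?Q" using \<open>a < b\<close> by (simp add: powr_diff)
  also have "\<dots> \<le> 1 * ?Q"
    using assms by (intro mult_right_mono powr_le1 integral_nonneg vq) auto
  finally have "(?I powr q) powr (1 / q) \<le> ?Q powr (1 / q)" using \<open>q \<ge> 1\<close> by (intro powr_mono2) auto
  then show ?thesis using \<open>q \<ge> 1\<close> I by (simp add: powr_powr)
qed

lemma spline_of_chain:
  fixes u :: "nat \<Rightarrow> real \<Rightarrow> real ^ 'd"
  assumes N: "is_norm N" and "q \<ge> 1" "m \<ge> 1" "n \<ge> 1"
    and chain: "\<And>j. j < m \<Longrightarrow> primitive (u j) (u (Suc j))" and um: "loc_int (u m)"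
    and Nq: "\<And>r. r \<le> m \<Longrightarrow> (\<lambda>t. N (u r t) powr q) integrable_on {0..1}"
    and bound: "\<And>r. r \<le> m \<Longrightarrow> Lq_norm N q (u r) \<le> \<alpha> r" and pos: "\<And>r. r \<le> m \<Longrightarrow> \<alpha> r > 0"
  shows "\<exists>s\<in>spline_multiball N m q n \<alpha>. curve_dist N s (u 0) \<le> \<alpha> 1 / real n"
proof -
  define h where "h = 1 / real n"
  have h: "h > 0" and nh: "real n * h = 1" using \<open>n \<ge> 1\<close> by (auto simp: h_def)
  have ur: "loc_int (u r)" if "r \<le> m" for r
    using chain[of r] um that primitive_loc_int by (cases "r = m") auto
  \<comment> \<open>\<open>P i\<close> is the mean of \<open>u 0\<close> over the cell from
    \<open>i h\<close> to \<open>(i + 1) h\<close>, for all integers \<open>i\<close>;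
    \<open>p\<close> is its periodization. A difference of order \<open>r\<close> at
    \<open>i\<close> with \<open>r \<le> i < n\<close> involves indices in \<open>{0..<n}\<close>
    only, where the two agree.\<close>
  define P where "P i = steklov h (u 0) (real_of_int i * h + h)" for i
  define p where "p i = P (i mod int n)" for i
  have pP: "p i = P i" if "0 \<le> i" "i < int n" for i using that by (simp add: p_def)
  have "real n ^ r * (\<Sum>i = r..<n. 1 / real n * N (discrete_deriv r p (int i)) powr q) powr (1 / q) \<le> \<alpha> r"
    if r: "r \<le> m" for r
  proof (cases "r \<le> n")
    case False
    then show ?thesis using pos[OF r] by simp
  next
    case True
    define y where "y = (steklov h ^^ r) (u r)"
    have rh: "real r * h \<le> 1" using True h mult_right_mono[of "real r" "real n" h] nh by simp
    have y: "loc_int y" unfolding y_def using ur[OF r] h by (rule loc_int_steklov_funpow)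
    have *: "(\<lambda>t. N (y t) powr q) integrable_on {real r * h..1}"
      "integral {real r * h..1} (\<lambda>t. N (y t) powr q) \<le> integral {0..1} (\<lambda>t. N (u r t) powr q)"
      using integral_is_norm_steklov_funpow_le[OF N ur[OF r] \<open>q \<ge> 1\<close> h, of 0 r 1] Nq[OF r] rh
      by (auto simp: y_def)
    have D: "real n ^ r *\<^sub>R discrete_deriv r p (int i) = steklov h y (real (Suc i) * h)" if "r \<le> i" "i < n" for i
    proof -
      have "discrete_deriv r p (int i) = discrete_deriv r P (int i)"
        by (rule discrete_deriv_cong) (use that pP in auto)
      moreover have "(diff_quot h ^^ r) (steklov h (u 0)) (real_of_int (int i) * h + h) = (1 / h) ^ r *\<^sub>R discrete_deriv r P (int i)"
        by (rule diff_quot_funpow_discrete) (simp add: P_def)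
      moreover have "(diff_quot h ^^ r) (steklov h (u 0)) = (steklov h ^^ r) (steklov h (u r))"
        by (rule diff_quot_funpow_chain[where u = "\<lambda>j. steklov h (u j)"])
          (use r chain h in \<open>auto intro: primitive_steklov_steklov\<close>)
      moreover have "\<dots> = steklov h y" by (simp add: y_def funpow_swap1)
      moreover have "real_of_int (int i) * h + h = real (Suc i) * h" by (simp add: algebra_simps)
      moreover have "1 / h = real n" by (simp add: h_def)
      ultimately show ?thesis by (simp only:)
    qed
    \<comment> \<open>Each term is a value of \<open>M y\<close> whose window is exactly cell
      \<open>i\<close>, so Jensen bounds it by the integral over that cell. The cells
      \<open>r\<close> to \<open>n - 1\<close> tile \<open>{real r * h..1}\<close>, where the
      \<open>r\<close>-fold average \<open>y\<close> is controlled.\<close>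
    have "(\<Sum>i = r..<n. 1 / real n * N (real n ^ r *\<^sub>R discrete_deriv r p (int i)) powr q) \<le>
        (\<Sum>i = r..<n. integral {real i * h..real (Suc i) * h} (\<lambda>t. N (y t) powr q))"
    proof (rule sum_mono)
      fix i assume i: "i \<in> {r..<n}"
      have e: "real (Suc i) * h - h = real i * h" by (simp add: algebra_simps)
      have "real r * h \<le> real i * h" "real (Suc i) * h \<le> real n * h"
        using i h by (intro mult_right_mono; simp)+
      then have "{real i * h..real (Suc i) * h} \<subseteq> {real r * h..1}" using nh by auto
      then have "(\<lambda>t. N (y t) powr q) integrable_on {real (Suc i) * h - h..real (Suc i) * h}"
        unfolding e by (rule integrable_subinterval_real[OF *(1)])
      from is_norm_steklov_powr_le[OF N y \<open>q \<ge> 1\<close> h this]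
      show "1 / real n * N (real n ^ r *\<^sub>R discrete_deriv r p (int i)) powr q \<le>
          integral {real i * h..real (Suc i) * h} (\<lambda>t. N (y t) powr q)"
        using D[of i] i \<open>n \<ge> 1\<close> unfolding e by (simp add: h_def field_simps)
    qed
    also have "\<dots> = integral {real r * h..1} (\<lambda>t. N (y t) powr q)"
    proof -
      have "((\<lambda>t. N (y t) powr q) has_integral (\<Sum>i = r..<n. integral {real i * h..real (Suc i) * h} (\<lambda>t. N (y t) powr q)))
          {real r * h..real n * h}"
      proof (rule has_integral_cells[OF True])
        fix i assume i: "r \<le> i" "i < n"
        have "real r * h \<le> real i * h" "real (Suc i) * h \<le> real n * h"
          using i h by (intro mult_right_mono; simp)+
        then show "((\<lambda>t. N (y t) powr q) has_integral integral {real i * h..real (Suc i) * h} (\<lambda>t. N (y t) powr q))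
            {real i * h..real (Suc i) * h}"
          by (intro integrable_integral integrable_subinterval_real[OF *(1)]) (auto simp: nh)
      qed (use h in simp)
      then show ?thesis using nh by (simp add: integral_unique)
    qed
    also note *(2)
    finally have "(\<Sum>i = r..<n. 1 / real n * N (real n ^ r *\<^sub>R discrete_deriv r p (int i)) powr q) powr (1 / q)
        \<le> Lq_norm N q (u r)"
      unfolding Lq_norm_def using \<open>q \<ge> 1\<close> by (intro powr_mono2) (auto intro!: sum_nonneg)
    then show ?thesis using bound[OF r] unfolding discrete_norm_eq[OF N \<open>q \<ge> 1\<close>] by simp
  qed
  moreover have "p \<in> discrete_curves n" by (simp add: discrete_curves_def p_def)
  ultimately have "zero_spline n p \<in> spline_multiball N m q n \<alpha>"
    by (simp add: spline_multiball_def discrete_multiball_def)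
  moreover have "curve_dist N (zero_spline n p) (u 0) \<le> \<alpha> 1 / real n"
  proof -
    define w where "w = (\<lambda>t. N (u 1 t))"
    have p01: "primitive (u 0) (u 1)" using chain[of 0] \<open>m \<ge> 1\<close> by simp
    have w: "loc_int w" unfolding w_def by (rule loc_int_is_norm[OF N ur]) (use \<open>m \<ge> 1\<close> in simp)
    define I where "I i = integral {real i * h..real (Suc i) * h} (\<lambda>t. N (p (int i) - u 0 t))" for i
    have "((\<lambda>t. N (zero_spline n p t - u 0 t)) has_integral (\<Sum>i = 0..<n. I i)) {real 0 * h..real n * h}"
    proof (rule has_integral_cells)
      fix i assume "i < n"
      have "(\<lambda>t. N (p (int i) - u 0 t)) integrable_on {real i * h..real (Suc i) * h}"
        by (intro loc_int_integrable loc_int_is_norm[OF N] loc_int_diff ur loc_int_continuous) auto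
      then have "((\<lambda>t. N (p (int i) - u 0 t)) has_integral I i) {real i * h..real (Suc i) * h}"
        unfolding I_def by (rule integrable_integral)
      then show "((\<lambda>t. N (zero_spline n p t - u 0 t)) has_integral I i) {real i * h..real (Suc i) * h}"
      proof (rule has_integral_spike_finite[rotated 2])
        show "finite {real i * h, real (Suc i) * h}" by simp
        fix t assume "t \<in> {real i * h..real (Suc i) * h} - {real i * h, real (Suc i) * h}"
        then have "\<lfloor>real n * t\<rfloor> = int i"
          using floor_on_cell[OF \<open>n \<ge> 1\<close>, of i t] by (simp add: h_def)
        then show "N (zero_spline n p t - u 0 t) = N (p (int i) - u 0 t)" by (simp add: zero_spline_def)
      qed
    qed (use h in auto)
    then have "curve_dist N (zero_spline n p) (u 0) = (\<Sum>i = 0..<n. I i)"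
      using nh by (simp add: curve_dist_def integral_unique)
    also have "\<dots> \<le> (\<Sum>i = 0..<n. h * integral {real i * h..real (Suc i) * h} w)"
    proof (rule sum_mono)
      fix i assume i: "i \<in> {0..<n}"
      let ?C = "{real i * h..real (Suc i) * h}"
      have e: "real (Suc i) * h - h = real i * h" by (simp add: algebra_simps)
      \<comment> \<open>On a cell, \<open>u 0\<close> oscillates by at most the integral of
        \<open>w\<close> there, and so differs from its mean by no more. The length of the cell
        contributes the factor \<open>h\<close>.\<close>
      have "N (p (int i) - u 0 t) \<le> integral ?C w" if "t \<in> ?C" for t
      proof -
        have "N (steklov h (u 0) (real (Suc i) * h) - u 0 t) \<le> integral ?C w"
          unfolding w_def
          by (rule steklov_close[OF N ur h], simp, rule primitive_is_norm_diff_le[OF N p01 _ that], simp only: e)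
        then show ?thesis using pP[of "int i"] i by (simp add: P_def algebra_simps)
      qed
      then have "I i \<le> integral ?C (\<lambda>_. integral ?C w)"
        unfolding I_def
        by (intro integral_le loc_int_integrable loc_int_is_norm[OF N] loc_int_diff ur loc_int_continuous) auto
      also have "\<dots> = h * integral ?C w" using h by (simp add: algebra_simps)
      finally show "I i \<le> h * integral ?C w" .
    qed
    also have "\<dots> = h * integral {0..1} w"
    proof -
      have "(w has_integral (\<Sum>i = 0..<n. integral {real i * h..real (Suc i) * h} w)) {real 0 * h..real n * h}"
        by (rule has_integral_cells) (use h loc_int_integrable[OF w] integrable_integral in auto)
      then show ?thesis using nh by (simp add: sum_distrib_left integral_unique)
    qed
    also have "integral {0..1} w \<le> Lq_norm N q (u 1)"
    proof -
      have "(\<lambda>t. w t powr q) integrable_on {0..1}" using Nq[of 1] \<open>m \<ge> 1\<close> by (simp add: w_def)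
      moreover have "w t \<ge> 0" for t by (simp add: w_def is_norm_nonneg[OF N])
      ultimately have "integral {0..1} w \<le> (integral {0..1} (\<lambda>t. w t powr q)) powr (1 / q)"
        by (intro integral_le_Lq \<open>q \<ge> 1\<close> loc_int_integrable[OF w]) simp_all
      then show ?thesis by (simp add: Lq_norm_def w_def)
    qed
    also have "\<dots> \<le> \<alpha> 1" using bound[of 1] \<open>m \<ge> 1\<close> by simp
    finally show ?thesis using h by (simp add: h_def divide_right_mono)
  qed
  ultimately show ?thesis by blast
qed

section \<open>From splines to Sobolev functions\<close>

text \<open>Periodicity leaves only finitely many values, so the spline is bounded on the whole
  line.\<close>

lemma loc_int_zero_spline:
  fixes p :: "int \<Rightarrow> real ^ 'd"
  assumes p: "p \<in> discrete_curves n" and "n \<ge> 1"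
  shows "loc_int (zero_spline n p)"
  unfolding loc_int_def
proof (intro allI)
  fix a b :: real
  have "p i \<in> p ` {0..<int n}" for i
  proof -
    have "p i = p (i mod int n)" using p by (simp add: discrete_curves_def)
    then show ?thesis using \<open>n \<ge> 1\<close> by simp
  qed
  then have "range p \<subseteq> p ` {0..<int n}" by blast
  then have "bounded (range p)" by (meson finite_atLeastLessThan_int finite_imageI finite_imp_bounded finite_subset)
  then obtain B where B: "\<And>i. norm (p i) \<le> B" unfolding bounded_iff by blast
  show "zero_spline n p absolutely_integrable_on {a..b}"
  proof (rule measurable_bounded_by_integrable_imp_absolutely_integrable)
    have "(\<lambda>t. p \<lfloor>real n * t\<rfloor>) \<in> borel_measurable borel"
      by measurable
    then have "zero_spline n p \<in> borel_measurable lborel" by (simp add: zero_spline_def[abs_def])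
    then show "zero_spline n p \<in> borel_measurable (lebesgue_on {a..b})"
      by (intro measurable_restrict_space1 measurable_completion)
    show "(\<lambda>t. B) integrable_on {a..b}" by (rule integrable_const_ivl)
    show "norm (zero_spline n p t) \<le> B" for t using B by (simp add: zero_spline_def)
  qed simp
qed

lemma diff_quot_funpow_zero_spline:
  fixes p :: "int \<Rightarrow> real ^ 'd"
  assumes "n \<ge> 1"
  shows "(diff_quot (1 / real n) ^^ r) (zero_spline n p) t = real n ^ r *\<^sub>R discrete_deriv r p \<lfloor>real n * t\<rfloor>"
proof -
  define i where "i = \<lfloor>real n * t\<rfloor>"
  \<comment> \<open>The position of \<open>t\<close> inside its cell. Moving by whole cells
    preserves it, so the grid identity applies at every \<open>t\<close>.\<close>
  define c where "c = t - real_of_int i * (1 / real n)"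
  have nc: "real n * c = real n * t - real_of_int i" using assms by (simp add: c_def right_diff_distrib)
  have "\<lfloor>real n * c\<rfloor> = 0" unfolding nc i_def by linarith
  moreover have "real n * (real_of_int j * (1 / real n) + c) = real n * c + real_of_int j" for j
    using assms by (simp add: algebra_simps)
  ultimately have "p j = zero_spline n p (real_of_int j * (1 / real n) + c)" for j
    by (simp add: zero_spline_def)
  from diff_quot_funpow_discrete[of p "zero_spline n p", OF this, of r i]
  have "(diff_quot (1 / real n) ^^ r) (zero_spline n p) (real_of_int i * (1 / real n) + c) =
      real n ^ r *\<^sub>R discrete_deriv r p i"
    by simp
  moreover have "real_of_int i * (1 / real n) + c = t" by (simp add: c_def)
  ultimately show ?thesis by (simp add: i_def)
qed

lemma has_integral_step_function:
  fixes F :: "int \<Rightarrow> real"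
  assumes "r \<le> n" "n \<ge> 1"
  shows "((\<lambda>t. F \<lfloor>real n * t\<rfloor>) has_integral (\<Sum>i = r..<n. 1 / real n * F (int i))) {real r / real n..1}"
proof -
  define h where "h = 1 / real n"
  have h: "h > 0" "real n * h = 1" using \<open>n \<ge> 1\<close> by (auto simp: h_def)
  have "((\<lambda>t. F \<lfloor>real n * t\<rfloor>) has_integral (\<Sum>i = r..<n. h * F (int i))) {real r * h..real n * h}"
  proof (rule has_integral_cells[OF \<open>r \<le> n\<close>])
    fix i assume "i < n"
    have "((\<lambda>t. F (int i)) has_integral (real (Suc i) * h - real i * h) *\<^sub>R F (int i)) {real i * h..real (Suc i) * h}"
      using has_integral_const_real[of "F (int i)" "real i * h" "real (Suc i) * h"] h by simp
    moreover have "(real (Suc i) * h - real i * h) *\<^sub>R F (int i) = h * F (int i)" by (simp add: algebra_simps)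
    ultimately have "((\<lambda>t. F (int i)) has_integral h * F (int i)) {real i * h..real (Suc i) * h}"
      by (simp only:)
    then show "((\<lambda>t. F \<lfloor>real n * t\<rfloor>) has_integral h * F (int i)) {real i * h..real (Suc i) * h}"
    proof (rule has_integral_spike_finite[rotated 2])
      show "finite {real i * h, real (Suc i) * h}" by simp
      fix t assume "t \<in> {real i * h..real (Suc i) * h} - {real i * h, real (Suc i) * h}"
      then have "\<lfloor>real n * t\<rfloor> = int i"
        using floor_on_cell[OF \<open>n \<ge> 1\<close>, of i t] by (simp add: h_def)
      then show "F \<lfloor>real n * t\<rfloor> = F (int i)" by simp
    qed
  qed (use h in simp)
  then show ?thesis using h(2) by (simp add: h_def)
qed

section \<open>Jumps of a spline inside a short window\<close>

lemma discrete_total_variation: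
  fixes p :: "int \<Rightarrow> 'a::real_vector"
  assumes N: "is_norm N" and "a \<le> b"
  shows "N (p b - p a) \<le> (\<Sum>j\<in>{a<..b}. N (p j - p (j - 1)))"
  using \<open>a \<le> b\<close>
proof (induction b rule: int_ge_induct)
  case (step b)
  have "{a<..b + 1} = insert (b + 1) {a<..b}" using step.hyps by auto
  then have "(\<Sum>j\<in>{a<..b + 1}. N (p j - p (j - 1))) = N (p (b + 1) - p b) + (\<Sum>j\<in>{a<..b}. N (p j - p (j - 1)))"
    by simp
  then show ?case using step.IH is_norm_triangle3[OF N, of "p (b + 1)" "p a" "p b"] by simp
qed (simp add: is_norm_zero[OF N])

text \<open>The \<open>j\<close>-th jump of the spline happens at \<open>j / n\<close>, so it matters for the window
  \<open>[\<tau> - l, \<tau>]\<close> only if \<open>\<tau> \<in> [j / n, j / n + l]\<close>. Excluding \<open>\<tau> = 1\<close> avoids the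
  wrap-around jump from \<open>p (n - 1)\<close> to \<open>p n = p 0\<close>.\<close>
lemma zero_spline_oscillation:
  fixes p :: "int \<Rightarrow> real ^ 'd"
  assumes N: "is_norm N" and "n \<ge> 1" and xy: "0 \<le> \<tau> - l" "\<tau> < 1" "x \<in> {\<tau> - l..\<tau>}" "y \<in> {\<tau> - l..\<tau>}"
  shows "N (zero_spline n p x - zero_spline n p y) \<le>
    (\<Sum>j\<in>{1..<int n}. N (p j - p (j - 1)) * indicator {real_of_int j / real n..real_of_int j / real n + l} \<tau>)"
    (is "_ \<le> ?B")
proof -
  have *: "N (zero_spline n p y - zero_spline n p x) \<le> ?B" if "\<tau> - l \<le> x" "x \<le> y" "y \<le> \<tau>" for x y
  proof -
    have le: "\<lfloor>real n * x\<rfloor> \<le> \<lfloor>real n * y\<rfloor>" using that by (intro floor_mono mult_left_mono) auto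
    have "N (zero_spline n p y - zero_spline n p x) \<le> (\<Sum>j\<in>{\<lfloor>real n * x\<rfloor><..\<lfloor>real n * y\<rfloor>}. N (p j - p (j - 1)))"
      unfolding zero_spline_def by (rule discrete_total_variation[OF N le])
    also have "\<dots> = (\<Sum>j\<in>{\<lfloor>real n * x\<rfloor><..\<lfloor>real n * y\<rfloor>}.
        N (p j - p (j - 1)) * indicator {real_of_int j / real n..real_of_int j / real n + l} \<tau>)"
    proof (rule sum.cong[OF refl])
      fix j assume j: "j \<in> {\<lfloor>real n * x\<rfloor><..\<lfloor>real n * y\<rfloor>}"
      then have "real n * x < real_of_int j" "real_of_int j \<le> real n * y" by (auto simp: floor_less_iff le_floor_iff)
      then have "x < real_of_int j / real n" "real_of_int j / real n \<le> y" using \<open>n \<ge> 1\<close> by (auto simp: field_simps)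
      then have "\<tau> \<in> {real_of_int j / real n..real_of_int j / real n + l}" using that by auto
      then show "N (p j - p (j - 1)) = N (p j - p (j - 1)) * indicator {real_of_int j / real n..real_of_int j / real n + l} \<tau>"
        by simp
    qed
    also have "\<dots> \<le> ?B"
    proof (rule sum_mono2)
      have "0 \<le> real n * x" using that xy by simp
      moreover have "real n * y < real n * 1" using that xy \<open>n \<ge> 1\<close> by (intro mult_strict_left_mono) auto
      ultimately have "0 \<le> \<lfloor>real n * x\<rfloor>" "\<lfloor>real n * y\<rfloor> < int n" by (auto simp: floor_less_iff)
      then show "{\<lfloor>real n * x\<rfloor><..\<lfloor>real n * y\<rfloor>} \<subseteq> {1..<int n}"
        by (intro subsetI, unfold greaterThanAtMost_iff atLeastLessThan_iff, linarith)
    qed (auto simp: is_norm_nonneg[OF N])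
    finally show ?thesis .
  qed
  show ?thesis
  proof (cases "x \<le> y")
    case True then show ?thesis using *[of x y] xy is_norm_commute[OF N] by (metis atLeastAtMost_iff)
  next
    case False then show ?thesis using *[of y x] xy by simp
  qed
qed

lemma integral_indicator_le:
  fixes a b c l :: real
  assumes "0 \<le> l"
  shows "(indicator {c..c + l} :: real \<Rightarrow> real) integrable_on {a..b}"
    and "integral {a..b} (indicator {c..c + l} :: real \<Rightarrow> real) \<le> l"
proof -
  have e: "(indicator {c..c + l} :: real \<Rightarrow> real) = (\<lambda>x. if x \<in> {c..c + l} then 1 else 0)" by (auto simp: indicator_def)
  have "{c..c + l} \<inter> {a..b} = {max c a..min (c + l) b}" by auto
  then have "((\<lambda>x::real. 1::real) has_integral measure lborel {max c a..min (c + l) b}) ({c..c + l} \<inter> {a..b})"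
    using has_integral_const_real[of "1::real" "max c a" "min (c + l) b"] by simp
  then have "((indicator {c..c + l} :: real \<Rightarrow> real) has_integral measure lborel {max c a..min (c + l) b}) {a..b}"
    unfolding e by (simp only: has_integral_restrict_Int)
  moreover have "measure lborel {max c a..min (c + l) b} \<le> l" using assms by (auto simp: content_real_if)
  ultimately show "(indicator {c..c + l} :: real \<Rightarrow> real) integrable_on {a..b}"
    "integral {a..b} (indicator {c..c + l} :: real \<Rightarrow> real) \<le> l"
    by (auto simp: integral_unique has_integral_integrable)
qed

text \<open>Applied with \<open>a = 1\<close>, where the wrap-around jump spoils the pointwise
  estimate.\<close>

lemma integral_le_except:
  fixes f g :: "real \<Rightarrow> real"
  assumes "f integrable_on S" "g integrable_on S" "\<And>x. x \<in> S - {a} \<Longrightarrow> f x \<le> g x"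
  shows "integral S f \<le> integral S g"
proof -
  let ?g = "\<lambda>x. if x = a then f a else g x"
  have "?g integrable_on S" by (rule integrable_spike_finite[of "{a}", OF _ _ assms(2)]) auto
  then have "integral S f \<le> integral S ?g" using assms(1,3) by (intro integral_le) auto
  also have "\<dots> = integral S g" by (rule integral_spike[of "{a}"]) auto
  finally show ?thesis .
qed

lemma primitive_scaleR: "primitive u w \<Longrightarrow> primitive (\<lambda>t. c *\<^sub>R u t) (\<lambda>t. c *\<^sub>R w t)"
  by (simp add: primitive_def loc_int_scaleR scaleR_diff_right)

lemma sobolev_multiballI:
  fixes u :: "nat \<Rightarrow> real \<Rightarrow> real ^ 'd"
  assumes N: "is_norm N" and "\<And>j. j < m \<Longrightarrow> primitive (u j) (u (Suc j))" "loc_int (u m)"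
    and "\<And>r. r \<le> m \<Longrightarrow> (\<lambda>t. N (u r t) powr q) integrable_on {0..1}"
    and "\<And>r. r \<le> m \<Longrightarrow> Lq_norm N q (u r) \<le> \<alpha> r"
  shows "u 0 \<in> sobolev_multiball N m q \<alpha>"
proof -
  have u: "loc_int (u r)" if "r \<le> m" for r
    using assms(2)[of r] assms(3) that primitive_loc_int by (cases "r = m") auto
  have "weak_deriv r (u 0) (u r)" if "r \<le> m" for r
    by (rule weak_deriv_primitive_chain) (use assms(2) u that in auto)
  moreover have "(\<lambda>t. N (u r t) powr q) absolutely_integrable_on {0..1}" if "r \<le> m" for r
    using assms(4)[OF that] by (intro nonnegative_absolutely_integrable_1) auto
  ultimately show ?thesis
    unfolding sobolev_multiball_def using loc_int_abs[OF u[of 0]] assms(5) by blast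
qed

text \<open>The approximant for \<open>n < 2 m\<close>, when the window is too long for
  smoothing.\<close>

lemma zero_in_sobolev_multiball:
  assumes N: "is_norm N" and "\<And>r. r \<le> m \<Longrightarrow> \<alpha> r > 0"
  shows "(\<lambda>_. 0) \<in> sobolev_multiball N m q \<alpha>"
proof -
  have z: "loc_int (\<lambda>_::real. 0)" by (simp add: loc_int_continuous)
  have "(\<lambda>j _. 0) 0 \<in> sobolev_multiball N m q \<alpha>"
    by (rule sobolev_multiballI[OF N])
      (use z assms in \<open>auto simp: primitive_def Lq_norm_def is_norm_zero less_imp_le\<close>)
  then show ?thesis by simp
qed

text \<open>\<open>D\<close> is a step function with values \<open>n^r \<Delta>^r p\<close>, so the
  discrete constraint is its \<open>L^q\<close> bound. The sum starts at \<open>i = r\<close>, hence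
  the left end \<open>r / n\<close>.\<close>

lemma zero_spline_Lq:
  fixes p :: "int \<Rightarrow> real ^ 'd"
  assumes N: "is_norm N" and p: "p \<in> discrete_multiball N m q n \<alpha>"
    and "n \<ge> 1" "q \<ge> 1" "r \<le> m" "r \<le> n"
  defines "D \<equiv> (diff_quot (1 / real n) ^^ r) (zero_spline n p)"
  shows "(\<lambda>t. N (D t) powr q) integrable_on {real r / real n..1}"
    and "(integral {real r / real n..1} (\<lambda>t. N (D t) powr q)) powr (1 / q) \<le> \<alpha> r"
proof -
  have D: "D t = real n ^ r *\<^sub>R discrete_deriv r p \<lfloor>real n * t\<rfloor>" for t
    unfolding D_def by (rule diff_quot_funpow_zero_spline[OF \<open>n \<ge> 1\<close>])
  have i: "((\<lambda>t. N (D t) powr q) has_integral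
      (\<Sum>i = r..<n. 1 / real n * N (real n ^ r *\<^sub>R discrete_deriv r p (int i)) powr q)) {real r / real n..1}"
    unfolding D using has_integral_step_function[OF \<open>r \<le> n\<close> \<open>n \<ge> 1\<close>] by fast
  then show "(\<lambda>t. N (D t) powr q) integrable_on {real r / real n..1}" by blast
  have "real n ^ r * (\<Sum>i = r..<n. 1 / real n * N (discrete_deriv r p (int i)) powr q) powr (1 / q) \<le> \<alpha> r"
    using p \<open>r \<le> m\<close> by (simp add: discrete_multiball_def)
  then show "(integral {real r / real n..1} (\<lambda>t. N (D t) powr q)) powr (1 / q) \<le> \<alpha> r"
    unfolding discrete_norm_eq[OF N \<open>q \<ge> 1\<close>] integral_unique[OF i] .
qed

text \<open>The sum of the interior jumps is the \<open>L^1\<close> norm of the first difference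
  quotient on \<open>[1 / n, 1]\<close>, an interval that is nondegenerate for
  \<open>n \<ge> 2\<close>.\<close>

lemma sum_jumps_le:
  fixes p :: "int \<Rightarrow> real ^ 'd"
  assumes N: "is_norm N" and p: "p \<in> discrete_multiball N m q n \<alpha>"
    and "n \<ge> 2" "q \<ge> 1" "m \<ge> 1"
  shows "(\<Sum>j\<in>{1..<int n}. N (p j - p (j - 1))) \<le> \<alpha> 1"
proof -
  define D where "D = (diff_quot (1 / real n) ^^ 1) (zero_spline n p)"
  have D: "D t = real n *\<^sub>R discrete_deriv 1 p \<lfloor>real n * t\<rfloor>" for t
    unfolding D_def using diff_quot_funpow_zero_spline[of n 1 p t] \<open>n \<ge> 2\<close> by simp
  have "((\<lambda>t. N (D t)) has_integral (\<Sum>i = 1..<n. 1 / real n * N (real n *\<^sub>R discrete_deriv 1 p (int i))))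
      {real 1 / real n..1}"
    unfolding D
    using has_integral_step_function[of 1 n "\<lambda>i. N (real n *\<^sub>R discrete_deriv 1 p i)"] \<open>n \<ge> 2\<close> by simp
  moreover have "(\<Sum>i = 1..<n. 1 / real n * N (real n *\<^sub>R discrete_deriv 1 p (int i))) =
      (\<Sum>i = 1..<n. N (p (int i) - p (int i - 1)))"
    using \<open>n \<ge> 2\<close> by (intro sum.cong) (simp_all add: is_norm_scaleR[OF N] discrete_deriv_Suc)
  ultimately have i: "((\<lambda>t. N (D t)) has_integral (\<Sum>i = 1..<n. N (p (int i) - p (int i - 1)))) {1 / real n..1}"
    by simp
  have "(\<Sum>j\<in>{1..<int n}. N (p j - p (j - 1))) = (\<Sum>i = 1..<n. N (p (int i) - p (int i - 1)))"
    by (rule sum.reindex_bij_witness[of _ int nat]) auto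
  also have "\<dots> = integral {1 / real n..1} (\<lambda>t. N (D t))" using i by (simp add: integral_unique)
  also have "\<dots> \<le> (integral {1 / real n..1} (\<lambda>t. N (D t) powr q)) powr (1 / q)"
    using zero_spline_Lq(1)[OF N p, of 1] i assms is_norm_nonneg[OF N]
    by (intro integral_le_Lq) (auto simp: D_def has_integral_integrable)
  also have "\<dots> \<le> \<alpha> 1" using zero_spline_Lq(2)[OF N p, of 1] assms by (simp add: D_def)
  finally show ?thesis .
qed

lemma zero_spline_L1:
  fixes p :: "int \<Rightarrow> real ^ 'd"
  assumes N: "is_norm N" and p: "p \<in> discrete_multiball N m q n \<alpha>" and "n \<ge> 1" "q \<ge> 1"
  shows "curve_dist N (zero_spline n p) (\<lambda>_. 0) \<le> \<alpha> 0"
proof -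
  have s: "loc_int (zero_spline n p)"
    using loc_int_zero_spline[of p n] p \<open>n \<ge> 1\<close> by (simp add: discrete_multiball_def)
  have "integral {0..1} (\<lambda>t. N (zero_spline n p t)) \<le>
      (integral {0..1} (\<lambda>t. N (zero_spline n p t) powr q)) powr (1 / q)"
    using zero_spline_Lq(1)[OF N p, of 0] assms is_norm_nonneg[OF N] loc_int_integrable[OF loc_int_is_norm[OF N s]]
    by (intro integral_le_Lq) auto
  then show ?thesis using zero_spline_Lq(2)[OF N p, of 0] assms by (simp add: curve_dist_def)
qed

lemma sobolev_of_spline:
  fixes p :: "int \<Rightarrow> real ^ 'd"
  assumes N: "is_norm N" and p: "p \<in> discrete_multiball N m q n \<alpha>"
    and "q \<ge> 1" "m \<ge> 1" "n \<ge> 2 * m"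
  shows "\<exists>f\<in>sobolev_multiball N m q \<alpha>. curve_dist N (zero_spline n p) f \<le> 2 * real m * (\<alpha> 0 + \<alpha> 1) / real n"
proof -
  define h where "h = 1 / real n"
  define l where "l = real m * h"
  define c where "c = 1 - l"
  define s where "s = zero_spline n p"
  define D where "D r = (diff_quot h ^^ r) s" for r
  define v where "v r = (steklov h ^^ (m - r)) (D r)" for r
  \<comment> \<open>The substitution maps \<open>{0..1}\<close> onto \<open>{l..1}\<close>. The
    chain rule accounts for \<open>c ^ r\<close>; the extra factor \<open>c\<close> absorbs the
    \<open>1 / c\<close> that the substitution puts before the \<open>L^q\<close> integral.\<close>
  define u where "u r t = c ^ Suc r *\<^sub>R v r (c * t + l)" for r t
  have n: "n \<ge> 1" "n \<ge> 2" using assms(4,5) by linarith+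
  have h: "h > 0" using n by (simp add: h_def)
  have l: "0 \<le> l" "l \<le> 1 / 2" using assms(4,5) n by (auto simp: l_def h_def field_simps)
  then have c: "1 / 2 \<le> c" "c > 0" "c \<le> 1" by (auto simp: c_def)
  have s: "loc_int s"
    unfolding s_def using loc_int_zero_spline[of p n] p n by (simp add: discrete_multiball_def)
  have D: "loc_int (D r)" for r unfolding D_def by (rule loc_int_diff_quot_funpow[OF s])
  have v: "loc_int (v r)" for r unfolding v_def by (rule loc_int_steklov_funpow[OF D h])
  have "primitive (v r) (v (Suc r))" if "r < m" for r
  proof -
    define k where "k = m - Suc r"
    have k: "m - r = Suc k" using that by (simp add: k_def)
    have "primitive (steklov h ((steklov h ^^ k) (D r))) (diff_quot h ((steklov h ^^ k) (D r)))"
      by (intro primitive_steklov loc_int_steklov_funpow D h)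
    also have "diff_quot h ((steklov h ^^ k) (D r)) = v (Suc r)"
      unfolding v_def k_def[symmetric] using steklov_funpow_diff_quot[OF D h] by (simp add: D_def)
    finally show ?thesis by (simp add: v_def k)
  qed
  then have "primitive (\<lambda>t. c ^ Suc r *\<^sub>R v r (c * t + l)) (\<lambda>t. c ^ Suc r *\<^sub>R c *\<^sub>R v (Suc r) (c * t + l))" if "r < m" for r
    using that c by (intro primitive_scaleR primitive_affine)
  then have chain: "primitive (u r) (u (Suc r))" if "r < m" for r
    using that by (simp add: u_def[abs_def] mult.commute)
  have um: "loc_int (u r)" if "r \<le> m" for r
  proof -
    have "primitive (\<lambda>t. signed_integral (v r) (c * t + l)) (\<lambda>t. c *\<^sub>R v r (c * t + l))"
      using primitive_affine[OF primitive_signed_integral[OF v, of 0] c(2)] by simp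
    then have "loc_int (\<lambda>t. c *\<^sub>R v r (c * t + l))" unfolding primitive_def by blast
    then have "loc_int (\<lambda>t. c ^ r *\<^sub>R c *\<^sub>R v r (c * t + l))" by (rule loc_int_scaleR)
    then show ?thesis by (simp add: u_def[abs_def] mult.commute)
  qed
  have vq: "(\<lambda>t. N (v r t) powr q) integrable_on {l..1} \<and>
      (integral {l..1} (\<lambda>t. N (v r t) powr q)) powr (1 / q) \<le> \<alpha> r" if "r \<le> m" for r
  proof -
    have rn: "r \<le> n" using that assms(5) by simp
    note Dq = zero_spline_Lq[OF N p n(1) \<open>q \<ge> 1\<close> that rn, folded h_def s_def, folded D_def]
    \<comment> \<open>The \<open>r\<close> difference quotients lose \<open>r h\<close> on the left
      and the \<open>m - r\<close> averages lose the rest, so every order ends at the same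
      \<open>l\<close>.\<close>
    have e: "real r / real n + real (m - r) * h = l" using that by (simp add: l_def h_def of_nat_diff flip: add_divide_distrib)
    have *: "(\<lambda>t. N (v r t) powr q) integrable_on {l..1}"
      "integral {l..1} (\<lambda>t. N (v r t) powr q) \<le> integral {real r / real n..1} (\<lambda>t. N (D r t) powr q)"
      using integral_is_norm_steklov_funpow_le[OF N D \<open>q \<ge> 1\<close> h, of "real r / real n" "m - r" 1, unfolded e] Dq(1) l
      by (auto simp: v_def)
    then have "(integral {l..1} (\<lambda>t. N (v r t) powr q)) powr (1 / q) \<le>
        (integral {real r / real n..1} (\<lambda>t. N (D r t) powr q)) powr (1 / q)"
      using \<open>q \<ge> 1\<close> by (intro powr_mono2 integral_nonneg) auto
    then show ?thesis using *(1) Dq(2) by simp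
  qed
  have uq: "(\<lambda>t. N (u r t) powr q) integrable_on {0..1} \<and> Lq_norm N q (u r) \<le> \<alpha> r" if "r \<le> m" for r
  proof -
    let ?I = "integral {l..1} (\<lambda>t. N (v r t) powr q)"
    have I: "?I \<ge> 0" by (intro integral_nonneg) (use vq[OF that] in auto)
    have "((\<lambda>t. N (v r t) powr q) has_integral ?I) {c * 0 + l..c * 1 + l}"
      using vq[OF that] integrable_integral by (auto simp: c_def)
    from has_integral_mult_right[OF has_integral_affine[OF this c(2)], of "(c ^ Suc r) powr q"]
    have i: "((\<lambda>t. N (u r t) powr q) has_integral (c ^ Suc r) powr q * (?I /\<^sub>R c)) {0..1}"
      using c by (simp add: u_def is_norm_scaleR[OF N] powr_mult is_norm_nonneg[OF N])
    \<comment> \<open>Here \<open>q \<ge> 1\<close> enters: the scaling contributes at most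
      \<open>c\<close> and cancels the \<open>1 / c\<close> of the substitution.\<close>
    have "(c ^ Suc r) powr q \<le> (c ^ Suc r) powr 1" using c \<open>q \<ge> 1\<close> power_le_one[of c "Suc r"]
      by (intro powr_mono') auto
    also have "\<dots> \<le> c" using c by (simp add: mult_left_le power_le_one)
    finally have "(c ^ Suc r) powr q * (?I /\<^sub>R c) \<le> c * (?I /\<^sub>R c)" using I c by (intro mult_right_mono) auto
    also have "\<dots> = ?I" using c by simp
    finally have "Lq_norm N q (u r) \<le> ?I powr (1 / q)"
      unfolding Lq_norm_def integral_unique[OF i] using \<open>q \<ge> 1\<close> I c by (intro powr_mono2) auto
    then show ?thesis using vq[OF that] i by auto
  qed
  have W: "u 0 \<in> sobolev_multiball N m q \<alpha>"
    by (rule sobolev_multiballI[OF N]) (use chain um uq in auto)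
  define a where "a j = N (p j - p (j - 1))" for j
  define B where "B x = (\<Sum>j\<in>{1..<int n}. a j * indicator {real_of_int j / real n..real_of_int j / real n + l} x)" for x :: real
  have close: "N (s t - v 0 (c * t + l)) \<le> B (c * t + l)" if t: "0 \<le> t" "t < 1" for t
  proof -
    \<comment> \<open>The stretched point keeps \<open>t\<close> in its window:
      \<open>\<tau> - l = c t \<le> t \<le> \<tau>\<close>. So \<open>M^m s\<close> at \<tau>
      averages values of \<open>s\<close> over a window containing \<open>t\<close>, and the
      oscillation there bounds the error.\<close>
    define \<tau> where "\<tau> = c * t + l"
    have "\<tau> = t + l * (1 - t)" "\<tau> = l + c * t" by (simp_all add: \<tau>_def c_def algebra_simps)
    moreover have "l * (1 - t) \<ge> 0" "l * (1 - t) \<le> l" "c * t \<ge> 0" "c * t < c"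
      using t l c by (simp_all add: mult_left_le)
    ultimately have \<tau>: "0 \<le> \<tau> - l" "\<tau> < 1" "t \<in> {\<tau> - l..\<tau>}" unfolding c_def by auto
    have "N ((steklov h ^^ m) s \<tau> - s t) \<le> B \<tau>"
      unfolding B_def a_def s_def
      by (rule steklov_funpow_close[OF N s[unfolded s_def] h], fold l_def, rule zero_spline_oscillation[OF N n(1) \<tau>(1,2) _ \<tau>(3)])
    then show ?thesis using is_norm_commute[OF N, of "s t"] by (simp add: \<tau>_def v_def D_def)
  qed
  have Bi: "B integrable_on {l..1}" "integral {l..1} B \<le> l * \<alpha> 1"
  proof -
    have summand: "(\<lambda>x. a j * indicator {real_of_int j / real n..real_of_int j / real n + l} x) integrable_on {l..1}" for j
      using integral_indicator_le(1)[OF l(1)] by (intro integrable_on_mult_right)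
    show "B integrable_on {l..1}" unfolding B_def[abs_def] by (intro integrable_sum summand) simp
    \<comment> \<open>Each jump is seen only for arguments in an interval of length
      \<open>l\<close>, so integration turns the oscillation bound into \<open>l\<close> times the
      total variation.\<close>
    have "integral {l..1} B = (\<Sum>j\<in>{1..<int n}. a j * integral {l..1} (indicator {real_of_int j / real n..real_of_int j / real n + l}))"
      unfolding B_def[abs_def] by (subst integral_sum) (use summand in auto)
    also have "\<dots> \<le> (\<Sum>j\<in>{1..<int n}. a j * l)"
      using integral_indicator_le(2)[OF l(1)] by (intro sum_mono mult_left_mono) (auto simp: a_def is_norm_nonneg[OF N])
    also have "\<dots> = l * (\<Sum>j\<in>{1..<int n}. a j)" by (simp add: sum_distrib_left mult.commute)
    also have "\<dots> \<le> l * \<alpha> 1"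
      using sum_jumps_le[OF N p n(2) assms(3,4)] l unfolding a_def by (intro mult_left_mono)
    finally show "integral {l..1} B \<le> l * \<alpha> 1" .
  qed
  have "(B has_integral integral {l..1} B) {c * 0 + l..c * 1 + l}"
    using Bi(1) integrable_integral by (auto simp: c_def)
  from has_integral_affine[OF this c(2)]
  have Bc: "((\<lambda>t. B (c * t + l)) has_integral (integral {l..1} B /\<^sub>R c)) {0..1}" .
  \<comment> \<open>Since \<open>u 0 t = c *\<^sub>R v 0 (c * t + l)\<close> and
    \<open>c = 1 - l\<close>, the rescaling error is \<open>l\<close> times \<open>v 0\<close>, that
    is \<open>l / c\<close> times \<open>u 0\<close>.\<close>
  define b where "b = l / c"
  have "curve_dist N s (u 0) \<le> integral {0..1} (\<lambda>t. B (c * t + l) + b * N (u 0 t))"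
    unfolding curve_dist_def
  proof (rule integral_le_except)
    show "(\<lambda>t. N (s t - u 0 t)) integrable_on {0..1}"
      by (intro loc_int_integrable loc_int_is_norm[OF N] loc_int_diff s um) simp
    show "(\<lambda>t. B (c * t + l) + b * N (u 0 t)) integrable_on {0..1}"
      by (intro integrable_add[OF has_integral_integrable[OF Bc]] integrable_on_mult_right
          loc_int_integrable loc_int_is_norm[OF N] um) simp
    fix t :: real assume t: "t \<in> {0..1} - {1}"
    have "N (s t - u 0 t) \<le> N (s t - v 0 (c * t + l)) + N (v 0 (c * t + l) - u 0 t)"
      by (rule is_norm_triangle3[OF N])
    also have "v 0 (c * t + l) - u 0 t = b *\<^sub>R u 0 t"
    proof -
      have "l *\<^sub>R v 0 (c * t + l) = v 0 (c * t + l) - u 0 t" by (simp add: u_def c_def scaleR_diff_left)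
      moreover have "b *\<^sub>R u 0 t = l *\<^sub>R v 0 (c * t + l)" using c by (simp add: u_def b_def)
      ultimately show ?thesis by simp
    qed
    also have "N (b *\<^sub>R u 0 t) = b * N (u 0 t)" using l c by (simp add: is_norm_scaleR[OF N] b_def)
    finally show "N (s t - u 0 t) \<le> B (c * t + l) + b * N (u 0 t)" using close[of t] t by auto
  qed
  also have "\<dots> = integral {l..1} B / c + b * integral {0..1} (\<lambda>t. N (u 0 t))"
  proof -
    have "(\<lambda>t. N (u 0 t)) integrable_on {0..1}" by (intro loc_int_integrable loc_int_is_norm[OF N] um) simp
    from has_integral_add[OF Bc has_integral_mult_right[OF integrable_integral[OF this], of b]]
    show ?thesis by (simp add: integral_unique divide_inverse mult.commute)
  qed
  also have "\<dots> \<le> l * \<alpha> 1 / c + b * \<alpha> 0"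
  proof -
    have "integral {0..1} (\<lambda>t. N (u 0 t)) \<le> Lq_norm N q (u 0)"
      unfolding Lq_norm_def using uq[of 0] is_norm_nonneg[OF N] \<open>q \<ge> 1\<close> loc_int_integrable[OF loc_int_is_norm[OF N um[of 0]]]
      by (intro integral_le_Lq) auto
    then have "integral {0..1} (\<lambda>t. N (u 0 t)) \<le> \<alpha> 0" using uq[of 0] by simp
    then show ?thesis using Bi(2) c l by (intro add_mono divide_right_mono mult_left_mono) (auto simp: b_def)
  qed
  also have "\<dots> = b * (\<alpha> 0 + \<alpha> 1)" by (simp add: b_def algebra_simps)
  also have "\<dots> \<le> 2 * l * (\<alpha> 0 + \<alpha> 1)"
  proof (rule mult_right_mono)
    \<comment> \<open>This is the factor 2 of the constant: \<open>c \<ge> 1 / 2\<close>, which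
      comes from \<open>n \<ge> 2 * m\<close>.\<close>
    have "l * 1 \<le> l * (2 * c)" using c l by (intro mult_left_mono) auto
    then show "b \<le> 2 * l" using c by (simp add: b_def field_simps)
    have "\<alpha> r \<ge> 0" if "r \<le> m" for r using uq[OF that] by (smt (verit) Lq_norm_def powr_ge_zero)
    then show "0 \<le> \<alpha> 0 + \<alpha> 1" using \<open>m \<ge> 1\<close> by simp
  qed
  also have "\<dots> = 2 * real m * (\<alpha> 0 + \<alpha> 1) / real n" by (simp add: l_def h_def)
  finally show ?thesis using W unfolding s_def by blast
qed

theorem theorem2p2:
  fixes N :: "real ^ 'd \<Rightarrow> real" and m :: nat and \<alpha> :: "nat \<Rightarrow> real"
  assumes "is_norm N"
    and "m \<ge> 1"
    and "\<And>r. r \<le> m \<Longrightarrow> \<alpha> r > 0"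
  shows "\<exists>\<kappa>::real. \<kappa> \<ge> 0 \<and>
    (\<forall>q::real. q \<ge> 1 \<longrightarrow> (\<forall>n::nat. n \<ge> 1 \<longrightarrow>
      hausdorff_curve_dist N (spline_multiball N m q n \<alpha>) (sobolev_multiball N m q \<alpha>)
        \<le> ennreal (\<kappa> / real n)))"
proof -
  define \<kappa> where "\<kappa> = \<alpha> 1 + 2 * real m * (\<alpha> 0 + \<alpha> 1)"
  have \<alpha>: "\<alpha> 0 > 0" "\<alpha> 1 > 0" using assms(2,3) by auto
  have "hausdorff_curve_dist N (spline_multiball N m q n \<alpha>) (sobolev_multiball N m q \<alpha>) \<le> ennreal (\<kappa> / real n)"
    if q: "q \<ge> 1" and n: "n \<ge> 1" for q :: real and n :: nat
  proof -
    have spline: "\<exists>g\<in>sobolev_multiball N m q \<alpha>. curve_dist N s g \<le> 2 * real m * (\<alpha> 0 + \<alpha> 1) / real n"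
      if "s \<in> spline_multiball N m q n \<alpha>" for s
    proof -
      from that obtain p where p: "p \<in> discrete_multiball N m q n \<alpha>" and s: "s = zero_spline n p"
        unfolding spline_multiball_def by blast
      show ?thesis
      proof (cases "n \<ge> 2 * m")
        case True
        then show ?thesis using sobolev_of_spline[OF assms(1) p q assms(2)] s by simp
      next
        case False
        \<comment> \<open>For \<open>n < 2 m\<close> the claimed bound exceeds \<alpha> 0, which
          already bounds the distance from the spline to the zero function.\<close>
        have "\<alpha> 0 * real n \<le> (\<alpha> 0 + \<alpha> 1) * (2 * real m)" using False \<alpha> by (intro mult_mono) auto
        then have "\<alpha> 0 \<le> 2 * real m * (\<alpha> 0 + \<alpha> 1) / real n" using n by (simp add: field_simps)
        then have "curve_dist N s (\<lambda>_. 0) \<le> 2 * real m * (\<alpha> 0 + \<alpha> 1) / real n"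
          using zero_spline_L1[OF assms(1) p n q] s by simp
        then show ?thesis using zero_in_sobolev_multiball[of N m \<alpha> q, OF assms(1,3)] by blast
      qed
    qed
    have sobolev: "\<exists>s\<in>spline_multiball N m q n \<alpha>. curve_dist N s f \<le> \<alpha> 1 / real n"
      if f: "f \<in> sobolev_multiball N m q \<alpha>" for f
    proof -
      obtain u where u: "\<forall>j<m. primitive (u j) (u (Suc j))" "loc_int (u m)"
        "negligible {t \<in> {0..1}. f t \<noteq> u 0 t}"
        "\<forall>r\<le>m. (\<lambda>t. N (u r t) powr q) integrable_on {0..1} \<and> Lq_norm N q (u r) \<le> \<alpha> r"
        by (rule sobolev_multiball_chain[OF assms(1) q f])
      have eq: "curve_dist N s f = curve_dist N s (u 0)" for s
        unfolding curve_dist_def by (rule integral_spike[OF u(3)]) auto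
      show ?thesis
        unfolding eq by (rule spline_of_chain[OF assms(1) q assms(2) n]) (use u assms(3) in auto)
    qed
    have "(SUP s\<in>spline_multiball N m q n \<alpha>. INF g\<in>sobolev_multiball N m q \<alpha>. ennreal (curve_dist N s g))
        \<le> ennreal (2 * real m * (\<alpha> 0 + \<alpha> 1) / real n)"
      using spline by (intro SUP_least) (meson INF_lower2 ennreal_leI)
    moreover have "(SUP g\<in>sobolev_multiball N m q \<alpha>. INF s\<in>spline_multiball N m q n \<alpha>. ennreal (curve_dist N s g))
        \<le> ennreal (\<alpha> 1 / real n)"
      using sobolev by (intro SUP_least) (meson INF_lower2 ennreal_leI)
    ultimately have "hausdorff_curve_dist N (spline_multiball N m q n \<alpha>) (sobolev_multiball N m q \<alpha>)
        \<le> ennreal (2 * real m * (\<alpha> 0 + \<alpha> 1) / real n) + ennreal (\<alpha> 1 / real n)"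
      unfolding hausdorff_curve_dist_def by (rule add_mono)
    also have "\<dots> = ennreal (\<kappa> / real n)"
      using \<alpha> by (simp add: \<kappa>_def add_divide_distrib add.commute flip: ennreal_plus)
    finally show ?thesis .
  qed
  moreover have "\<kappa> \<ge> 0" using \<alpha> by (simp add: \<kappa>_def)
  ultimately show ?thesis by blast
qed

end
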